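(* Let $p$ be a prime, $q=p^l$, $n\ge 2$ and $k\ge1$ integers, and let $d=\gcd(k,q-1)$. If $q\ge (d-1)^4+6d$, then every matrix in $M_n(\mathbb F_q)$ is of the form $A^k+B^k$ with $A,B\in M_n(\mathbb F_q)$ split semisimple.
   Context: A matrix over a field $K$ is split semisimple (diagonalizable) if its minimal polynomial is a product of distinct monic polynomials of degree $1$ in $K[x]$. *)

theory Defs
  imports "Jordan_Normal_Form.Matrix"
    "HOL-Computational_Algebra.Polynomial"
    "HOL-Computational_Algebra.Primes"
    "HOL-Library.Cardinality"
begin

text \<open>
  For a square matrix \<open>A\<close>, \<open>poly_at_mat f A\<close> is the matrix \<open>f(A)\<close>, that is, the sum of
  \<open>coeff f m\<close> times \<open>A ^\<^sub>m m\<close>. The sum is taken entrywise because \<open>'a mat\<close> carries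
  its dimensions as data and so has no zero element to sum from.
\<close>

definition poly_at_mat :: "'a :: comm_ring_1 poly \<Rightarrow> 'a mat \<Rightarrow> 'a mat" where
  "poly_at_mat f A =
     mat (dim_row A) (dim_row A) (\<lambda>(i, j). \<Sum>m\<le>degree f. coeff f m * (A ^\<^sub>m m) $$ (i, j))"

definition annihilates :: "'a :: comm_ring_1 poly \<Rightarrow> 'a mat \<Rightarrow> bool" where
  "annihilates f A \<longleftrightarrow> poly_at_mat f A = 0\<^sub>m (dim_row A) (dim_row A)"

definition is_minimal_poly :: "'a :: field mat \<Rightarrow> 'a poly \<Rightarrow> bool" where
  "is_minimal_poly A f \<longleftrightarrow>
     lead_coeff f = 1 \<and> annihilates f A \<and>
     (\<forall>g. g \<noteq> 0 \<and> annihilates g A \<longrightarrow> degree f \<le> degree g)"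

definition split_semisimple :: "'a :: field mat \<Rightarrow> bool" where
  "split_semisimple A \<longleftrightarrow>
     square_mat A \<and>
     (\<exists>f P. is_minimal_poly A f \<and> finite P \<and>
            (\<forall>g\<in>P. lead_coeff g = 1 \<and> degree g = 1) \<and> f = \<Prod>P)"

end

theory Submission
  imports Defs "Jordan_Normal_Form.Determinant"
begin

text \<open>
  Let \<open>S\<close> be the set of \<open>k\<close>-th powers and \<open>h = (q - 1) / d\<close>; its nonzero elements are the \<open>h\<close>-th roots
  of unity. Counting the values of \<open>x \<mapsto> (x ^ h, (1 - x) ^ h)\<close> and their coincidences, Cauchy-Schwarz
  shows that every field element is a sum of two elements of \<open>S\<close>, so no Weil bound is needed.

  It suffices to write \<open>M\<close> as a sum of two matrices diagonalizable with eigenvalues in \<open>S\<close>, and this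
  property passes to similar matrices and to direct sums. Take \<open>m\<close> maximal such that there are a functional
  \<open>f\<close> and a vector \<open>v\<close> with \<open>f M\<^sup>i v = 0\<close> for \<open>i < m\<close> and \<open>f M\<^sup>m v = 1\<close>. By maximality the span of
  \<open>v, \<dots>, M\<^sup>m v\<close> and the common kernel of \<open>f, \<dots>, f M\<^sup>m\<close> are complementary invariant subspaces, so a
  companion block splits off. Such a block is similar to a bidiagonal matrix plus a last row whose diagonal
  can be prescribed up to its sum, and with diagonal entries chosen as sums of two elements of \<open>S\<close> it is the
  sum of two matrices which are visibly diagonalizable.
\<close>

section \<open>Powers in finite fields\<close>

lemma CARD_field_gt_1: "1 < CARD('a :: {field, finite})"
proof -
  have "card {0, 1 :: 'a} \<le> CARD('a)"
    by (rule card_mono) auto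
  then show ?thesis
    by simp
qed

lemma nonzero_power_CARD_minus_one:
  fixes x :: "'a :: {field, finite}"
  assumes "x \<noteq> 0"
  shows "x ^ (CARD('a) - 1) = 1"
proof -
  let ?U = "UNIV - {0 :: 'a}"
  have bij: "bij_betw ((*) x) ?U ?U"
    using assms by (intro bij_betwI[of _ _ _ "\<lambda>y. y / x"]) auto
  have "\<Prod>?U = (\<Prod>y\<in>?U. x * y)"
    using prod.reindex_bij_betw[OF bij, of "\<lambda>y. y"] by simp
  also have "\<dots> = x ^ card ?U * \<Prod>?U"
    by (simp add: prod.distrib)
  finally have "x ^ card ?U = 1"
    by simp
  then show ?thesis
    by (simp add: card_Diff_singleton)
qed

lemma card_roots_of_unity_le:
  fixes m :: nat
  assumes "0 < m"
  shows "card {x :: 'a :: {field, finite}. x ^ m = 1} \<le> m"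
proof -
  let ?p = "monom (1 :: 'a) m + [:-1:]"
  have "coeff ?p m = 1"
    using assms by (cases m) auto
  then have "?p \<noteq> 0"
    by (metis coeff_0 zero_neq_one)
  then have "card {x. poly ?p x = 0} \<le> degree ?p"
    by (rule card_poly_roots_bound)
  also have "\<dots> \<le> m"
    by (rule degree_add_le) (auto simp: degree_monom_le)
  finally show ?thesis
    by (simp add: poly_monom)
qed

lemma sum_card_fibres:
  assumes "finite Z" "finite R"
  shows "(\<Sum>p\<in>R. card {x \<in> Z. g x = p}) = card {x \<in> Z. g x \<in> R}"
proof -
  have "{x \<in> Z. g x \<in> R} = (\<Union>p\<in>R. {x \<in> Z. g x = p})"
    by auto
  also have "card \<dots> = (\<Sum>p\<in>R. card {x \<in> Z. g x = p})"
    using assms by (intro card_UN_disjoint) auto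
  finally show ?thesis ..
qed

lemma sum_card_fibres_squared:
  assumes "finite Z" "finite R" "g ` Z \<subseteq> R"
  shows "(\<Sum>p\<in>R. (card {x \<in> Z. g x = p})\<^sup>2) = card {(x, y) \<in> Z \<times> Z. g x = g y}"
proof -
  have "{(x, y) \<in> Z \<times> Z. g x = g y} = (\<Union>p\<in>R. {x \<in> Z. g x = p} \<times> {x \<in> Z. g x = p})"
    using assms by auto
  also have "card \<dots> = (\<Sum>p\<in>R. card ({x \<in> Z. g x = p} \<times> {x \<in> Z. g x = p}))"
    using assms by (intro card_UN_disjoint) auto
  finally show ?thesis
    by (simp add: card_cartesian_product power2_eq_square)
qed

lemma card_power_fibre:
  fixes x :: "'a :: {field, finite}"
  assumes "x \<noteq> 0"
  shows "card {y. y ^ m = x ^ m} = card {y :: 'a. y ^ m = 1}"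
proof (rule bij_betw_same_card)
  show "bij_betw (\<lambda>y. y / x) {y. y ^ m = x ^ m} {y. y ^ m = 1}"
    using assms by (intro bij_betwI[of _ _ _ "\<lambda>y. y * x"]) (auto simp: power_divide power_mult_distrib)
qed

text \<open>Every nonempty fibre of \<open>x ^ m\<close> on the units is a coset of the kernel. The
  inequality bounds either factor from below once the other is bounded from above.\<close>

lemma card_nonzero_le_power_image:
  "CARD('a :: {field, finite}) - 1
    \<le> card ((\<lambda>x :: 'a. x ^ m) ` (UNIV - {0})) * card {y :: 'a. y ^ m = 1}"
proof -
  let ?Z = "UNIV - {0 :: 'a}" and ?g = "\<lambda>x :: 'a. x ^ m"
  have "CARD('a) - 1 = card {x \<in> ?Z. ?g x \<in> ?g ` ?Z}"
  proof -
    have "{x \<in> ?Z. ?g x \<in> ?g ` ?Z} = ?Z"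
      by auto
    then show ?thesis
      by (simp add: card_Diff_singleton)
  qed
  also have "\<dots> = (\<Sum>p\<in>?g ` ?Z. card {x \<in> ?Z. ?g x = p})"
    by (rule sum_card_fibres[symmetric]) auto
  also have "\<dots> \<le> (\<Sum>p\<in>?g ` ?Z. card {y :: 'a. y ^ m = 1})"
  proof (rule sum_mono)
    fix p assume "p \<in> ?g ` ?Z"
    then obtain x where x: "x \<noteq> 0" "p = x ^ m"
      by auto
    have "card {x \<in> ?Z. ?g x = p} \<le> card {y. y ^ m = x ^ m}"
      by (rule card_mono) (auto simp: x)
    then show "card {x \<in> ?Z. ?g x = p} \<le> card {y :: 'a. y ^ m = 1}"
      using card_power_fibre[OF x(1), of m] by simp
  qed
  finally show ?thesis
    by simp
qed

text \<open>The \<open>h\<close>-th powers of units are \<open>d\<close>-th roots of unity, so there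
  are at most \<open>d\<close> of them and the kernel of \<open>x ^ h\<close> has at least
  \<open>h\<close> elements. Fibre counting thus takes the place of the cyclicity of the unit
  group.\<close>

lemma card_roots_of_unity:
  fixes d h :: nat
  assumes "CARD('a :: {field, finite}) - 1 = d * h" "0 < h"
  shows "card {x :: 'a. x ^ h = 1} = h"
proof -
  have d: "0 < d"
    using CARD_field_gt_1[where 'a = 'a] assms by (cases d) auto
  have "(\<lambda>x :: 'a. x ^ h) ` (UNIV - {0}) \<subseteq> {x. x ^ d = 1}"
    using nonzero_power_CARD_minus_one[where 'a = 'a] assms
    by (auto simp: power_mult[symmetric] mult.commute)
  then have "card ((\<lambda>x :: 'a. x ^ h) ` (UNIV - {0})) \<le> d"
    by (rule order.trans[OF card_mono[OF finite] card_roots_of_unity_le[OF d]])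
  from order.trans[OF card_nonzero_le_power_image mult_le_mono1[OF this]]
  have "d * h \<le> d * card {y :: 'a. y ^ h = 1}"
    unfolding assms(1) .
  then have "h \<le> card {y :: 'a. y ^ h = 1}"
    using d by simp
  then show ?thesis
    using card_roots_of_unity_le[OF assms(2), where 'a = 'a] by simp
qed

text \<open>The \<open>k\<close>-th powers of units lie among the \<open>h\<close>-th roots of
  unity, of which there are \<open>h\<close>. By Bezout, \<open>y ^ k = 1\<close> implies
  \<open>y ^ d = 1\<close>, so the kernel has at most \<open>d\<close> elements, the image has at
  least \<open>h\<close>, and the inclusion is an equality.\<close>

lemma range_power_iff:
  fixes x :: "'a :: {field, finite}" and k :: nat
  assumes "1 \<le> k"
  defines "h \<equiv> (CARD('a) - 1) div gcd k (CARD('a) - 1)"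
  shows "x \<in> range (\<lambda>y. y ^ k) \<longleftrightarrow> x = 0 \<or> x ^ h = 1"
proof -
  let ?q = "CARD('a) - 1" and ?I = "(\<lambda>y :: 'a. y ^ k) ` (UNIV - {0})"
  define d where "d = gcd k ?q"
  have q: "0 < ?q"
    using CARD_field_gt_1[where 'a = 'a] by simp
  have d: "0 < d" "d dvd k" "?q = d * h"
    using assms by (auto simp: d_def h_def)
  then have h: "0 < h"
    using q by (cases h) auto
  have sub: "?I \<subseteq> {x. x ^ h = 1}"
  proof clarify
    fix y :: 'a assume "y \<noteq> 0"
    obtain m where "k = d * m"
      using d by auto
    then have "k * h = ?q * m"
      using d by simp
    then show "(y ^ k) ^ h = 1"
      using nonzero_power_CARD_minus_one[OF \<open>y \<noteq> 0\<close>] by (simp flip: power_mult) (simp add: power_mult)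
  qed
  have "{y :: 'a. y ^ k = 1} \<subseteq> {y. y ^ d = 1}"
  proof clarify
    fix y :: 'a assume y: "y ^ k = 1"
    obtain a b where "a * k = b * ?q + d"
      using bezout_nat[of k ?q] assms unfolding d_def by (metis mult.commute not_one_le_zero)
    then have "(y ^ k) ^ a = (y ^ ?q) ^ b * y ^ d"
      by (metis mult.commute power_add power_mult)
    moreover have "y \<noteq> 0"
      using y assms by (auto simp: power_0_left)
    ultimately show "y ^ d = 1"
      using y nonzero_power_CARD_minus_one[of y] by simp
  qed
  then have "card {y :: 'a. y ^ k = 1} \<le> d"
    by (rule order.trans[OF card_mono[OF finite] card_roots_of_unity_le[OF d(1)]])
  then have "d * h \<le> card ?I * d"
    using order.trans[OF card_nonzero_le_power_image[where 'a = 'a, of k] mult_le_mono2] d by simp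
  then have "card {x :: 'a. x ^ h = 1} \<le> card ?I"
    using d(1) card_roots_of_unity[OF d(3) h] by (simp add: mult.commute)
  then have "?I = {x. x ^ h = 1}"
    using sub by (intro card_seteq) auto
  moreover have "range (\<lambda>y :: 'a. y ^ k) = insert 0 ?I"
    using assms by (auto simp: power_0_left image_iff)
  ultimately show ?thesis
    by auto
qed

section \<open>Every field element is a sum of two \<open>k\<close>-th powers\<close>

lemma sum_squares_ge_tangent:
  fixes t :: "'b \<Rightarrow> real"
  assumes "finite A" "real (card A) \<le> c"
  shows "2 * m * sum t A - m\<^sup>2 * c \<le> (\<Sum>i\<in>A. (t i)\<^sup>2)"
proof -
  \<comment> \<open>Each square lies above its tangent at \<open>m\<close>. With
    \<open>m = sum t A / c\<close> the result is Cauchy-Schwarz, free of division by the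
    cardinality, of which only the upper bound \<open>c\<close> is known.\<close>
  have "2 * m * sum t A - m\<^sup>2 * real (card A) = (\<Sum>i\<in>A. 2 * m * t i - m\<^sup>2)"
    by (simp add: sum_subtractf flip: sum_distrib_left)
  also have "\<dots> \<le> (\<Sum>i\<in>A. (t i)\<^sup>2)"
  proof (rule sum_mono)
    fix i
    have "0 \<le> (t i - m)\<^sup>2"
      by simp
    then show "2 * m * t i - m\<^sup>2 \<le> (t i)\<^sup>2"
      by (simp add: power2_diff algebra_simps)
  qed
  finally show ?thesis
    using mult_left_mono[OF assms(2), of "m\<^sup>2"] by simp
qed

text \<open>A coincidence \<open>x ^ h = y ^ h\<close>, \<open>(1 - x) ^ h = (1 - y) ^ h\<close> with \<open>x \<noteq> y\<close> is determined by the
  two distinct nontrivial \<open>h\<close>-th roots of unity \<open>x / y\<close> and \<open>(1 - x) / (1 - y)\<close>.\<close>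

lemma card_power_coincidences_le:
  fixes Z :: "'a :: {field, finite} set" and d h :: nat
  assumes q: "CARD('a) - 1 = d * h" and h: "0 < h"
  defines "Z \<equiv> UNIV - {0, 1}"
  shows "card {(x, y) \<in> Z \<times> Z. (x ^ h, (1 - x) ^ h) = (y ^ h, (1 - y) ^ h)}
    \<le> card Z + (h - 1) * (h - 2)"
proof -
  let ?C = "{(x, y) \<in> Z \<times> Z. (x ^ h, (1 - x) ^ h) = (y ^ h, (1 - y) ^ h)}"
  let ?D = "(\<lambda>x. (x, x)) ` Z"
  let ?V = "{x :: 'a. x ^ h = 1} - {1}"
  let ?W = "SIGMA u : ?V. ?V - {u}"
  let ?f = "\<lambda>(x :: 'a, y). (x / y, (1 - x) / (1 - y))"
  have V: "card ?V = h - 1"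
    using card_roots_of_unity[OF q h] by (simp add: card_Diff_singleton)
  have W: "card ?W = (h - 1) * (h - 2)"
  proof -
    have "card ?W = (\<Sum>u\<in>?V. card (?V - {u}))"
      by (simp add: card_SigmaI)
    also have "\<dots> = (\<Sum>u\<in>?V. h - 2)"
      by (rule sum.cong) (use V in \<open>auto simp: card_Diff_singleton\<close>)
    finally show ?thesis
      using V by simp
  qed
  have inj: "inj_on ?f (?C - ?D)"
  proof (rule inj_onI, clarify)
    fix x y x' y'
    assume xy: "(x, y) \<notin> ?D" "x \<in> Z" "y \<in> Z" and xy': "(x', y') \<notin> ?D" "x' \<in> Z" "y' \<in> Z"
      and e: "x / y = x' / y'" "(1 - x) / (1 - y) = (1 - x') / (1 - y')"
    \<comment> \<open>Eliminating \<open>x\<close> gives \<open>(u - v) * y = 1 - v\<close>. This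
      determines \<open>y\<close>, because \<open>u = v\<close> would force both to be 1 and hence
      \<open>x = y\<close>.\<close>
    define u v where "u = x / y" and "v = (1 - x) / (1 - y)"
    have nz: "y \<noteq> 0" "y' \<noteq> 0" "1 - y \<noteq> 0" "1 - y' \<noteq> 0" "x \<noteq> y"
      using xy xy' by (auto simp: Z_def)
    have x: "x = u * y" "x' = u * y'"
      unfolding u_def using nz(1) by simp (unfold e(1), use nz(2) in simp)
    have "1 - x = v * (1 - y)" "1 - x' = v * (1 - y')"
      unfolding v_def using nz(3) by simp (unfold e(2), use nz(4) in simp)
    then have y: "(u - v) * y = 1 - v" "(u - v) * y' = 1 - v"
      unfolding x by (auto simp: algebra_simps)
    have "u \<noteq> v"
    proof
      assume "u = v"
      then have "u = 1"
        using y by simp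
      then show False
        using x nz by simp
    qed
    then have "y = y'"
      using y by (metis eq_iff_diff_eq_0 mult_left_cancel)
    then show "x = x' \<and> y = y'"
      using x by simp
  qed
  have sub: "?f ` (?C - ?D) \<subseteq> ?W"
  proof (rule image_subsetI)
    fix z
    assume "z \<in> ?C - ?D"
    then obtain x y where z: "z = (x, y)" and xy: "(x, y) \<notin> ?D" "x \<in> Z" "y \<in> Z"
      "x ^ h = y ^ h" "(1 - x) ^ h = (1 - y) ^ h"
      by blast
    then have nz: "x \<noteq> y" "x \<noteq> 0" "y \<noteq> 0" "1 - y \<noteq> 0"
      by (auto simp: Z_def)
    have "x / y \<noteq> (1 - x) / (1 - y)"
      using nz by (simp add: frac_eq_eq algebra_simps)
    moreover have "x / y \<noteq> 1" "(1 - x) / (1 - y) \<noteq> 1"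
      using nz by auto
    moreover have "(x / y) ^ h = 1" "((1 - x) / (1 - y)) ^ h = 1"
      using xy nz by (auto simp: power_divide)
    ultimately show "?f z \<in> ?W"
      by (simp add: z)
  qed
  have "card (?C - ?D) \<le> card ?W"
    by (rule card_inj_on_le[OF inj sub finite])
  moreover have "card ?D = card Z"
    by (rule card_image) (auto simp: inj_on_def)
  moreover have "card ?C \<le> card (?D \<union> (?C - ?D))"
    by (rule card_mono) auto
  moreover have "card (?D \<union> (?C - ?D)) \<le> card ?D + card (?C - ?D)"
    by (rule card_Un_le)
  ultimately show ?thesis
    using W by linarith
qed

text \<open>If \<open>c\<close> were not such a sum, the map \<open>g\<close> from \<open>Z\<close>
  to pairs of \<open>d\<close>-th roots of unity would miss the cell \<open>(a, a)\<close>, while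
  row \<open>a\<close> and column \<open>a\<close> still receive \<open>h\<close> points each. So
  uneven a distribution has many coincidences, more than \<open>card_power_coincidences_le\<close>
  permits.\<close>

lemma all_sums_of_two_powers:
  fixes c :: "'a :: {field, finite}" and d h :: nat
  assumes q: "CARD('a) - 1 = d * h" and le: "(d - 1) ^ 4 + 6 * d \<le> CARD('a)"
    and S: "S = {x :: 'a. x = 0 \<or> x ^ h = 1}"
  shows "\<exists>x\<in>S. \<exists>y\<in>S. c = x + y"
proof (rule ccontr)
  assume no: "\<not> ?thesis"
  have q1: "1 < CARD('a)"
    by (rule CARD_field_gt_1)
  then have "0 < d * h"
    using q by linarith
  then have dh: "0 < d" "0 < h"
    by (auto simp only: nat_0_less_mult_iff)
  have "0 \<in> S"
    by (simp add: S)
  then have "c \<notin> S"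
    using no by force
  then have c: "c \<noteq> 0" "c ^ h \<noteq> 1"
    unfolding S by blast+
  \<comment> \<open>If \<open>x ^ h = a\<close> then \<open>c * x\<close> is an \<open>h\<close>-th
    root of unity. As \<open>c = c * x + c * (1 - x)\<close>, no \<open>x\<close> has both
    \<open>x ^ h\<close> and \<open>(1 - x) ^ h\<close> equal to \<open>a\<close>.\<close>
  define a where "a = (1 / c) ^ h"
  have a: "a \<noteq> 0" "a \<noteq> 1"
    unfolding a_def power_one_over using c by simp_all
  define Z where "Z = UNIV - {0, 1 :: 'a}"
  define g where "g = (\<lambda>x :: 'a. (x ^ h, (1 - x) ^ h))"
  define T where "T = (\<lambda>p. card {x \<in> Z. g x = p})"
  define I where "I = {x :: 'a. x ^ d = 1}"
  have unit: "(x ^ h) ^ d = 1" if "x \<noteq> 0" for x :: 'a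
    using nonzero_power_CARD_minus_one[OF that] unfolding q power_mult[symmetric] mult.commute[of h] .
  have aI: "a \<in> I"
    using unit[of "1 / c"] c(1) by (simp add: a_def I_def)
  have gI: "g ` Z \<subseteq> I \<times> I"
  proof (rule image_subsetI)
    fix x assume "x \<in> Z"
    then show "g x \<in> I \<times> I"
      using unit[of x] unit[of "1 - x"] by (simp add: Z_def g_def I_def)
  qed
  define J where "J = I - {a}"
  have "card I \<le> d"
    unfolding I_def by (rule card_roots_of_unity_le[OF dh(1)])
  then have J: "card J \<le> d - 1"
    using aI by (simp add: J_def card_Diff_singleton)
  have "1 \<in> J"
    using a by (simp add: J_def I_def)
  then have "0 < card J"
    by (auto simp: card_gt_0_iff)
  then have d2: "2 \<le> d"
    using J by simp
  define e where "e = real d - 1"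
  have e: "1 \<le> e" "real (card J) \<le> e"
    using d2 J by (auto simp: e_def)
  have Z: "card Z = d * h - 1"
    using q by (simp add: Z_def card_Diff_subset)
  have none: "g x \<noteq> (a, a)" for x
  proof
    assume "g x = (a, a)"
    then have "c * x \<in> S" "c * (1 - x) \<in> S"
      using c by (auto simp: g_def S a_def power_mult_distrib power_divide)
    then have "c \<noteq> c * x + c * (1 - x)"
      using no by blast
    then show False
      by (simp add: algebra_simps)
  qed
  have fib: "card {x. x ^ h = a} = h"
    using card_power_fibre[of "1 / c" h] card_roots_of_unity[OF q dh(2)] c by (simp add: a_def)
  \<comment> \<open>Row \<open>a\<close>, column \<open>a\<close> and the rest of the grid, always
    without the empty cell \<open>(a, a)\<close>. The excluded points 0 and 1 do not affect the
    first two counts, since \<open>a\<close> is neither 0 nor 1.\<close>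
  define R1 R2 R3 where "R1 = {a} \<times> J" and "R2 = J \<times> {a}" and "R3 = J \<times> J"
  have "{x \<in> Z. g x \<in> R1} = {x. x ^ h = a}"
    using gI none a dh by (auto simp: R1_def J_def Z_def g_def image_subset_iff power_0_left)
  then have s1: "(\<Sum>p\<in>R1. T p) = h"
    unfolding T_def by (subst sum_card_fibres) (auto simp: fib)
  have "{x \<in> Z. g x \<in> R2} = {x. (1 - x) ^ h = a}"
    using gI none a dh by (auto simp: R2_def J_def Z_def g_def image_subset_iff power_0_left)
  also have "card \<dots> = card {x. x ^ h = a}"
    by (rule bij_betw_same_card[of "\<lambda>x. 1 - x"]) (rule bij_betwI[of _ _ _ "\<lambda>x. 1 - x"], auto)
  finally have s2: "(\<Sum>p\<in>R2. T p) = h"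
    unfolding T_def by (subst sum_card_fibres) (auto simp: fib)
  have un: "I \<times> I - {(a, a)} = R1 \<union> (R2 \<union> R3)"
    using aI by (auto simp: R1_def R2_def R3_def J_def)
  have split: "(\<Sum>p\<in>I \<times> I. f p) = sum f R1 + (sum f R2 + sum f R3)"
    if "f (a, a) = 0" for f :: "'a \<times> 'a \<Rightarrow> real"
  proof -
    have "(\<Sum>p\<in>I \<times> I. f p) = sum f (I \<times> I - {(a, a)})"
      using that aI by (simp add: sum_diff1)
    also have "\<dots> = sum f R1 + sum f (R2 \<union> R3)"
      unfolding un by (rule sum.union_disjoint) (auto simp: R1_def R2_def R3_def J_def)
    also have "sum f (R2 \<union> R3) = sum f R2 + sum f R3"
      by (rule sum.union_disjoint) (auto simp: R1_def R2_def R3_def J_def)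
    finally show ?thesis .
  qed
  have T0: "T (a, a) = 0"
    using none by (simp add: T_def)
  have "(\<Sum>p\<in>I \<times> I. T p) = card {x \<in> Z. g x \<in> I \<times> I}"
    unfolding T_def by (rule sum_card_fibres) auto
  also have "{x \<in> Z. g x \<in> I \<times> I} = Z"
    using gI by auto
  finally have "real (d * h - 1) = (\<Sum>p\<in>I \<times> I. real (T p))"
    by (simp add: Z flip: of_nat_sum)
  also have "\<dots> = real h + (real h + (\<Sum>p\<in>R3. real (T p)))"
    using split[of "\<lambda>p. real (T p)"] T0 s1 s2 by (simp flip: of_nat_sum)
  \<comment> \<open>The total is \<open>q - 2 = d * h - 1\<close>, of which the row and the column
    take \<open>2 * h\<close>; here \<open>d = e + 1\<close>.\<close>
  finally have s3: "(\<Sum>p\<in>R3. real (T p)) = (e - 1) * real h - 1"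
    using dh by (simp add: e_def of_nat_diff algebra_simps)
  let ?h = "real h"
  \<comment> \<open>In \<open>t1\<close>, \<open>t2\<close> and \<open>t3\<close> the tangent point
    is the total over the region divided by the bound on its number of cells, which is the optimal
    choice.\<close>
  have t1: "2 * (?h / e) * ?h - (?h / e)\<^sup>2 * e \<le> (\<Sum>p\<in>R1. (real (T p))\<^sup>2)"
    using sum_squares_ge_tangent[of R1 e "?h / e" "\<lambda>p. real (T p)"] e s1
    by (simp add: R1_def card_cartesian_product flip: of_nat_sum)
  have t2: "2 * (?h / e) * ?h - (?h / e)\<^sup>2 * e \<le> (\<Sum>p\<in>R2. (real (T p))\<^sup>2)"
    using sum_squares_ge_tangent[of R2 e "?h / e" "\<lambda>p. real (T p)"] e s2
    by (simp add: R2_def card_cartesian_product flip: of_nat_sum)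
  let ?N = "(e - 1) * ?h - 1"
  have "real (card R3) \<le> e\<^sup>2"
    using e by (simp add: R3_def card_cartesian_product power2_eq_square mult_mono)
  then have t3: "2 * (?N / e\<^sup>2) * ?N - (?N / e\<^sup>2)\<^sup>2 * e\<^sup>2 \<le> (\<Sum>p\<in>R3. (real (T p))\<^sup>2)"
    using sum_squares_ge_tangent[of R3 "e\<^sup>2" "?N / e\<^sup>2" "\<lambda>p. real (T p)"] s3 by simp
  have "(\<Sum>p\<in>I \<times> I. (T p)\<^sup>2) = card {(x, y) \<in> Z \<times> Z. g x = g y}"
    unfolding T_def by (rule sum_card_fibres_squared) (use gI in auto)
  also have "\<dots> \<le> card Z + (h - 1) * (h - 2)"
    unfolding g_def Z_def by (rule card_power_coincidences_le[OF q dh(2)])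
  finally have "real (\<Sum>p\<in>I \<times> I. (T p)\<^sup>2) \<le> real (d * h - 1 + (h - 1) * (h - 2))"
    unfolding Z by (rule of_nat_mono)
  moreover have "real (\<Sum>p\<in>I \<times> I. (T p)\<^sup>2) =
      (\<Sum>p\<in>R1. (real (T p))\<^sup>2) + ((\<Sum>p\<in>R2. (real (T p))\<^sup>2) + (\<Sum>p\<in>R3. (real (T p))\<^sup>2))"
    using split[of "\<lambda>p. (real (T p))\<^sup>2"] T0 by simp
  \<comment> \<open>The case \<open>h = 1\<close> is separate because \<open>h - 2\<close> is then
    truncated to 0; the product vanishes either way.\<close>
  moreover have "real (d * h - 1 + (h - 1) * (h - 2)) = ?h\<^sup>2 + (e - 2) * ?h + 1"
  proof (cases "h = 1")
    case True
    then show ?thesis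
      using d2 by (simp add: e_def of_nat_diff)
  next
    case False
    then have "real (h - 2) = ?h - 2" "real (h - 1) = ?h - 1" "real (d * h - 1) = real d * ?h - 1"
      using dh by (auto simp: of_nat_diff)
    then have "real (d * h - 1 + (h - 1) * (h - 2)) = real d * ?h - 1 + (?h - 1) * (?h - 2)"
      by (simp only: of_nat_add of_nat_mult)
    then show ?thesis
      by (simp add: e_def power2_eq_square algebra_simps)
  qed
  moreover have "2 * (?h / e) * ?h - (?h / e)\<^sup>2 * e = ?h\<^sup>2 * e / e\<^sup>2"
    using e by (simp add: field_simps power2_eq_square)
  moreover have "2 * (?N / e\<^sup>2) * ?N - (?N / e\<^sup>2)\<^sup>2 * e\<^sup>2 = ?N\<^sup>2 / e\<^sup>2"
    using e by (simp add: field_simps power2_eq_square)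
  ultimately have "2 * (?h\<^sup>2 * e / e\<^sup>2) + ?N\<^sup>2 / e\<^sup>2 \<le> ?h\<^sup>2 + (e - 2) * ?h + 1"
    using t1 t2 t3 by linarith
  then have "(2 * (?h\<^sup>2 * e) + ?N\<^sup>2) / e\<^sup>2 \<le> ?h\<^sup>2 + (e - 2) * ?h + 1"
    by (simp add: add_divide_distrib)
  then have "2 * (?h\<^sup>2 * e) + ?N\<^sup>2 \<le> (?h\<^sup>2 + (e - 2) * ?h + 1) * e\<^sup>2"
    using e by (simp add: pos_divide_le_eq)
  \<comment> \<open>The terms \<open>e ^ 2 * h ^ 2\<close> on the two sides cancel, leaving a
    quadratic inequality in \<open>h\<close>.\<close>
  then have upper: "?h * (?h - (e ^ 3 - 2 * e\<^sup>2 + 2 * e - 2)) \<le> e\<^sup>2 - 1"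
    by (simp add: power2_eq_square power3_eq_cube algebra_simps)
  have "real ((d - 1) ^ 4 + 6 * d) \<le> real (d * h + 1)"
    using le q q1 by (intro of_nat_mono) simp
  moreover have "real (d - 1) = e" "real d = e + 1"
    using d2 by (auto simp: e_def)
  ultimately have "e ^ 4 + 6 * (e + 1) \<le> (e + 1) * ?h + 1"
    by (simp only: of_nat_add of_nat_mult of_nat_power of_nat_numeral of_nat_1)
  \<comment> \<open>The bound on \<open>q\<close> enters here: \<open>e ^ 4 + 6 * e + 5\<close> is
    exactly divisible by \<open>e + 1\<close>, that is by \<open>d\<close>.\<close>
  then have "(e + 1) * (e ^ 3 - e\<^sup>2 + e + 5) \<le> (e + 1) * ?h"
    by (simp add: power2_eq_square power3_eq_cube power4_eq_xxxx algebra_simps)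
  then have low: "e ^ 3 - e\<^sup>2 + e + 5 \<le> ?h"
    using e by (simp add: mult_le_cancel_left)
  \<comment> \<open>By \<open>low\<close>, both factors on the left of \<open>upper\<close> are at
    least \<open>e\<close>; for the second one this is \<open>e ^ 2 - e + 7 \<ge> e\<close>. Their
    product is then at least \<open>e ^ 2\<close>, which exceeds \<open>e ^ 2 - 1\<close>.\<close>
  have "e \<le> e\<^sup>2" "e\<^sup>2 \<le> e ^ 3"
    using e by (auto simp: power2_eq_square power3_eq_cube)
  moreover have "0 \<le> (e - 1)\<^sup>2"
    by simp
  ultimately have "e \<le> ?h" "e \<le> ?h - (e ^ 3 - 2 * e\<^sup>2 + 2 * e - 2)"
    using low e unfolding power2_diff by auto
  then have "e * e \<le> ?h * (?h - (e ^ 3 - 2 * e\<^sup>2 + 2 * e - 2))"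
    using e by (intro mult_mono) auto
  then show False
    using upper by (simp add: power2_eq_square)
qed

text \<open>These four values become the last two diagonal entries of the two summands of a
  companion block, with \<open>t\<close> fixed by the trace. Pick \<open>u\<close> and
  \<open>z\<close> and write \<open>t - u - z = x + y\<close>. If \<open>x \<noteq> y\<close>, take
  \<open>b = z\<close>; if \<open>x = y\<close>, exchange roles and use \<open>b = x\<close> with
  the pair \<open>z\<close>, \<open>x\<close>. The second case needs \<open>z\<close> to avoid
  finitely many values.\<close>

lemma exists_sum_of_four_distinct:
  fixes S :: "'a :: field set"
  assumes two: "\<And>c. \<exists>x\<in>S. \<exists>y\<in>S. c = x + y"
    and S: "0 \<in> S" "1 \<in> S" "finite S" "6 \<le> card S"
  shows "\<exists>u\<in>S. \<exists>b\<in>S. \<exists>x\<in>S. \<exists>y\<in>S. u \<noteq> 0 \<and> b \<notin> {0, 1, u} \<and> x \<noteq> y \<and> t = u + b + x + y"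
proof -
  have avoid: "\<exists>z\<in>S. z \<notin> set E" if "length E \<le> 5" for E
  proof (rule ccontr)
    assume "\<not> ?thesis"
    then have "card S \<le> card (set E)"
      by (intro card_mono) auto
    then show False
      using card_length[of E] that S(4) by linarith
  qed
  have main: ?thesis
    if u: "u \<in> S" "u \<noteq> 0" and z: "z \<in> S" "z \<notin> {0, 1, u, t - u, t - u - 2, t - u - 2 * u}" "3 * z \<noteq> t - u"
    for u z
  proof -
    obtain x y where xy: "x \<in> S" "y \<in> S" "t - u - z = x + y"
      using two by blast
    then have t: "t = u + z + x + y"
      by (simp add: algebra_simps)
    show ?thesis
    proof (cases "x = y")
      case False
      then show ?thesis
        using u z xy t by blast
    next
      case True
      have e: "t - u - 2 * x = z" "t - u = z + 2 * x"
        using True t by auto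
      have "x \<noteq> 0" "x \<noteq> 1" "x \<noteq> u"
        using e z(2) by auto
      moreover have "x \<noteq> z"
        using e z(3) by auto
      moreover have "t = u + x + z + x"
        using True t by simp
      ultimately show ?thesis
        using u z xy
        by - (rule bexI[of _ u], rule bexI[of _ x], rule bexI[of _ z], rule bexI[of _ x], auto)
    qed
  qed
  show ?thesis
  \<comment> \<open>The choice \<open>u = 1\<close> merges some of the forbidden values, so five
    exclusions suffice. It fails only when \<open>3 * z = t - u\<close> holds for every
    \<open>z\<close>, that is in characteristic 3 with \<open>t = 1\<close>; any other nonzero
    \<open>u\<close> then works, and there \<open>t - u - 2 * u\<close> is 1, already
    excluded.\<close>
  proof (cases "(3 :: 'a) = 0 \<and> t = 1")
    case True
    obtain u where u: "u \<in> S" "u \<notin> set [0, 1]"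
      using avoid[of "[0, 1]"] by auto
    obtain z where z: "z \<in> S" "z \<notin> set [0, 1, u, t - u, t - u - 2]"
      using avoid[of "[0, 1, u, t - u, t - u - 2]"] by auto
    have "t - u - 2 * u = 1 - 3 * u"
      using True by (simp add: algebra_simps)
    then show ?thesis
      using u z True by (intro main[of u z]) auto
  next
    case False
    obtain z where z: "z \<in> S" "z \<notin> set [0, 1, t - 1, t - 1 - 2, (t - 1) / 3]"
      using avoid[of "[0, 1, t - 1, t - 1 - 2, (t - 1) / 3]"] by auto
    have "3 * z \<noteq> t - 1"
      using False z(2) by (cases "(3 :: 'a) = 0") (auto simp: mult.commute)
    then show ?thesis
      using z S by (intro main[of 1 z]) auto
  qed
qed

section \<open>Sums of diagonalizable matrices\<close>

definition diagonalizable_in :: "'a :: field set \<Rightarrow> 'a mat \<Rightarrow> bool" where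
  "diagonalizable_in S A \<longleftrightarrow> (\<exists>f. (\<forall>i<dim_row A. f i \<in> S) \<and> similar_mat A (mat_diag (dim_row A) f))"

definition sum_of_diagonalizable_in :: "'a :: field set \<Rightarrow> 'a mat \<Rightarrow> bool" where
  "sum_of_diagonalizable_in S M \<longleftrightarrow>
     (\<exists>A B. A \<in> carrier_mat (dim_row M) (dim_row M) \<and> B \<in> carrier_mat (dim_row M) (dim_row M) \<and>
        diagonalizable_in S A \<and> diagonalizable_in S B \<and> M = A + B)"

lemma dim_row_mat_diag [simp]: "dim_row (mat_diag n f) = n"
  by (simp add: mat_diag_def)

lemma dim_col_mat_diag [simp]: "dim_col (mat_diag n f) = n"
  by (simp add: mat_diag_def)

lemma diagonalizable_in_similar:
  assumes "similar_mat A B" "diagonalizable_in S B"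
  shows "diagonalizable_in S A"
proof -
  have "dim_row A = dim_row B"
    using similar_matD[OF assms(1)] by auto
  then show ?thesis
    using assms similar_mat_trans unfolding diagonalizable_in_def by metis
qed

lemma diagonalizable_in_four_block:
  assumes "diagonalizable_in S A" "diagonalizable_in S B"
    and A: "A \<in> carrier_mat n n" and B: "B \<in> carrier_mat m m"
  shows "diagonalizable_in S (four_block_mat A (0\<^sub>m n m) (0\<^sub>m m n) B)"
proof -
  obtain f where f: "\<forall>i<n. f i \<in> S" "similar_mat A (mat_diag n f)"
    using assms unfolding diagonalizable_in_def by auto
  obtain g where g: "\<forall>i<m. g i \<in> S" "similar_mat B (mat_diag m g)"
    using assms unfolding diagonalizable_in_def by auto
  let ?h = "\<lambda>i. if i < n then f i else g (i - n)"
  have "four_block_mat (mat_diag n f) (0\<^sub>m n m) (0\<^sub>m m n) (mat_diag m g) = mat_diag (n + m) ?h"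
    by (rule eq_matI) (auto simp: mat_diag_def)
  then have "similar_mat (four_block_mat A (0\<^sub>m n m) (0\<^sub>m m n) B) (mat_diag (n + m) ?h)"
    using similar_mat_four_block_0_0[OF f(2) g(2) A B] by simp
  then show ?thesis
    unfolding diagonalizable_in_def using f(1) g(1) A B
    by (intro exI[of _ ?h]) auto
qed

lemma sum_of_diagonalizable_in_similar:
  assumes sim: "similar_mat M M'" and sum: "sum_of_diagonalizable_in S M'"
  shows "sum_of_diagonalizable_in S M"
proof -
  obtain n P Q where c: "{M, M', P, Q} \<subseteq> carrier_mat n n" and PQ: "P * Q = 1\<^sub>m n" "Q * P = 1\<^sub>m n"
    and M: "M = P * M' * Q"
    using similar_matD[OF sim] by blast
  obtain A B where A: "A \<in> carrier_mat n n" and B: "B \<in> carrier_mat n n"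
    and d: "diagonalizable_in S A" "diagonalizable_in S B" and M': "M' = A + B"
    using sum c unfolding sum_of_diagonalizable_in_def by auto
  have sA: "similar_mat (P * A * Q) A" and sB: "similar_mat (P * B * Q) B"
    using c PQ A B by (auto intro!: similar_matI[of _ _ P Q n])
  have dim: "dim_row M = n" and cA: "P * A * Q \<in> carrier_mat n n" and cB: "P * B * Q \<in> carrier_mat n n"
    using c A B by auto
  have "P * A \<in> carrier_mat n n" "P * B \<in> carrier_mat n n" "Q \<in> carrier_mat n n" "P \<in> carrier_mat n n"
    using c A B by auto
  then have "M = P * A * Q + P * B * Q"
    unfolding M M' using A B
    by (simp add: mult_add_distrib_mat[of P n n] add_mult_distrib_mat[of "P * A" n n "P * B" Q n])
  then show ?thesis
    unfolding sum_of_diagonalizable_in_def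
    using dim cA cB diagonalizable_in_similar[OF sA d(1)] diagonalizable_in_similar[OF sB d(2)]
    by metis
qed

lemma sum_of_diagonalizable_in_four_block:
  assumes s: "sum_of_diagonalizable_in S M" "sum_of_diagonalizable_in S M'"
    and M: "M \<in> carrier_mat n n" and M': "M' \<in> carrier_mat m m"
  shows "sum_of_diagonalizable_in S (four_block_mat M (0\<^sub>m n m) (0\<^sub>m m n) M')"
proof -
  obtain A B where A: "A \<in> carrier_mat n n" and B: "B \<in> carrier_mat n n"
    and d: "diagonalizable_in S A" "diagonalizable_in S B" "M = A + B"
    using s(1) M unfolding sum_of_diagonalizable_in_def by auto
  obtain A' B' where A': "A' \<in> carrier_mat m m" and B': "B' \<in> carrier_mat m m"
    and d': "diagonalizable_in S A'" "diagonalizable_in S B'" "M' = A' + B'"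
    using s(2) M' unfolding sum_of_diagonalizable_in_def by auto
  let ?F = "\<lambda>X Y. four_block_mat X (0\<^sub>m n m) (0\<^sub>m m n) Y"
  have "?F M M' = ?F A A' + ?F B B'"
    unfolding d d' using A B A' B' by (subst add_four_block_mat) auto
  then show ?thesis
    unfolding sum_of_diagonalizable_in_def
    using M M' A B A' B' diagonalizable_in_four_block[OF d(1) d'(1) A A'] diagonalizable_in_four_block[OF d(2) d'(2) B B']
    by (intro exI[of _ "?F A A'"] exI[of _ "?F B B'"]) auto
qed

text \<open>The conjugating matrix is \<open>1 + X\<close> with \<open>X\<^sub>i\<^sub>j = N\<^sub>i\<^sub>j / (a\<^sub>j - a\<^sub>i)\<close>; the condition on the rows
  of \<open>N\<close> gives \<open>X\<^sup>2 = N X = 0\<close>.\<close>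

lemma similar_mat_diag_plus:
  fixes a :: "nat \<Rightarrow> 'a :: field"
  assumes N: "N \<in> carrier_mat n n"
    and ne: "\<And>i j. i < n \<Longrightarrow> j < n \<Longrightarrow> N $$ (i, j) \<noteq> 0 \<Longrightarrow> a i \<noteq> a j"
    and z: "\<And>i j k. i < n \<Longrightarrow> j < n \<Longrightarrow> k < n \<Longrightarrow> N $$ (i, j) \<noteq> 0 \<Longrightarrow> N $$ (j, k) = 0"
  shows "similar_mat (mat_diag n a + N) (mat_diag n a)"
proof -
  define X where "X = mat n n (\<lambda>(i, j). N $$ (i, j) / (a j - a i))"
  let ?D = "mat_diag n a" and ?I = "1\<^sub>m n :: 'a mat"
  have X: "X \<in> carrier_mat n n"
    by (simp add: X_def)
  have D: "?D \<in> carrier_mat n n"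
    by simp
  have zz: "N $$ (i, k) = 0 \<or> N $$ (k, j) = 0" if "i < n" "j < n" "k < n" for i j k
    using z[OF that(1) that(3) that(2)] by blast
  have XX: "X * X = 0\<^sub>m n n"
  proof (rule eq_matI)
    fix i j assume ij: "i < dim_row (0\<^sub>m n n :: 'a mat)" "j < dim_col (0\<^sub>m n n :: 'a mat)"
    have "(X * X) $$ (i, j) = (\<Sum>k<n. X $$ (i, k) * X $$ (k, j))"
      using X ij by (auto simp: scalar_prod_def lessThan_atLeast0)
    also have "\<dots> = 0"
      using ij zz[of i j] by (intro sum.neutral) (force simp: X_def)
    finally show "(X * X) $$ (i, j) = 0\<^sub>m n n $$ (i, j)"
      using ij by simp
  qed (use X in auto)
  have NX: "N * X = 0\<^sub>m n n"
  proof (rule eq_matI)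
    fix i j assume ij: "i < dim_row (0\<^sub>m n n :: 'a mat)" "j < dim_col (0\<^sub>m n n :: 'a mat)"
    have "(N * X) $$ (i, j) = (\<Sum>k<n. N $$ (i, k) * X $$ (k, j))"
      using N X ij by (auto simp: scalar_prod_def lessThan_atLeast0)
    also have "\<dots> = 0"
      using ij zz[of i j] by (intro sum.neutral) (force simp: X_def)
    finally show "(N * X) $$ (i, j) = 0\<^sub>m n n $$ (i, j)"
      using ij by simp
  qed (use N X in auto)
  \<comment> \<open>Up to rearrangement this says that \<open>N\<close> is the commutator of
    \<open>X\<close> with the diagonal matrix, which is how the denominators of \<open>X\<close>
    were chosen.\<close>
  have ND: "?D + N + ?D * X = ?D + X * ?D"
    unfolding mat_diag_mult_left[OF X] mat_diag_mult_right[OF X] using N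
  proof (intro eq_matI)
    fix i j
    assume "i < dim_row (?D + mat n n (\<lambda>(i, j). X $$ (i, j) * a j))"
      "j < dim_col (?D + mat n n (\<lambda>(i, j). X $$ (i, j) * a j))"
    then have ij: "i < n" "j < n"
      by auto
    have "N $$ (i, j) = X $$ (i, j) * (a j - a i)"
      using ne[OF ij] ij by (cases "N $$ (i, j) = 0") (auto simp: X_def)
    then show "(?D + N + mat n n (\<lambda>(i, j). a i * X $$ (i, j))) $$ (i, j)
        = (?D + mat n n (\<lambda>(i, j). X $$ (i, j) * a j)) $$ (i, j)"
      using ij N by (simp add: algebra_simps)
  qed auto
  have inv: "(?I + X) * (?I - X) = ?I"
  proof -
    have "(?I + X) * (?I - X) = (?I + X) * ?I - (?I + X) * X"
      using X by (intro mult_minus_distrib_mat) auto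
    also have "\<dots> = ?I"
      using X XX by (simp add: add_mult_distrib_mat[of ?I n n X X n]) (auto intro!: eq_matI)
    finally show ?thesis .
  qed
  have inv': "(?I - X) * (?I + X) = ?I"
    by (rule mat_mult_left_right_inverse[OF _ _ inv]) (use X in auto)
  have "(?D + N) * (?I + X) = (?D + N) + (?D * X + N * X)"
    using X N D by (simp add: mult_add_distrib_mat[of "?D + N" n n ?I n X] add_mult_distrib_mat[of ?D n n N X n])
  also have "\<dots> = (?I + X) * ?D"
    using X N D NX ND mult_carrier_mat[OF D X]
    by (simp add: add_mult_distrib_mat[of ?I n n X ?D n] right_add_zero_mat[of _ n n] left_mult_one_mat[of ?D n n])
  finally have e: "(?D + N) * (?I + X) = (?I + X) * ?D" .
  have "?D + N = (?D + N) * ((?I + X) * (?I - X))"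
    unfolding inv using N D by simp
  also have "\<dots> = (?D + N) * (?I + X) * (?I - X)"
    by (rule assoc_mult_mat[symmetric]) (use X N D in auto)
  also have "\<dots> = (?I + X) * ?D * (?I - X)"
    unfolding e ..
  finally show ?thesis
    using X N D inv inv' by (intro similar_matI[of _ _ "?I + X" "?I - X" n]) auto
qed

text \<open>Diagonalizing \<open>B\<close> by a block conjugation leaves only entries in the last
  row off the diagonal. They are removed by \<open>similar_mat_diag_plus\<close>, which applies
  because \<open>b\<close> differs from all eigenvalues of \<open>B\<close>.\<close>

lemma diagonalizable_in_block_triangular:
  assumes d: "diagonalizable_in (S - {b}) B" and b: "b \<in> S"
    and B: "B \<in> carrier_mat m m" and L: "L \<in> carrier_mat 1 m"
  shows "diagonalizable_in S (four_block_mat B (0\<^sub>m m 1) L (mat_diag 1 (\<lambda>_. b)))"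
proof -
  obtain f where f: "\<forall>i<m. f i \<in> S - {b}" and sim: "similar_mat B (mat_diag m f)"
    using d B unfolding diagonalizable_in_def by auto
  obtain P Q where w: "similar_mat_wit B (mat_diag m f) P Q"
    using sim unfolding similar_mat_def by blast
  note w' = similar_mat_witD2[OF B w]
  let ?b = "mat_diag 1 (\<lambda>_. b)"
  have LQ: "L = 1\<^sub>m 1 * (L * P) * Q"
    using L w' by (simp add: assoc_mult_mat[of L 1 m P m Q m])
  have "similar_mat_wit (four_block_mat B (0\<^sub>m m 1) L ?b) (four_block_mat (mat_diag m f) (0\<^sub>m m 1) (L * P) ?b)
     (four_block_mat P (0\<^sub>m m 1) (0\<^sub>m 1 m) (1\<^sub>m 1)) (four_block_mat Q (0\<^sub>m m 1) (0\<^sub>m 1 m) (1\<^sub>m 1))"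
    using w' L LQ by (intro similar_mat_wit_four_block[OF w similar_mat_wit_refl _ _ B]) auto
  then have s1: "similar_mat (four_block_mat B (0\<^sub>m m 1) L ?b) (four_block_mat (mat_diag m f) (0\<^sub>m m 1) (L * P) ?b)"
    unfolding similar_mat_def by blast
  let ?g = "\<lambda>i. if i < m then f i else b"
  let ?N = "four_block_mat (0\<^sub>m m m) (0\<^sub>m m 1) (L * P) (0\<^sub>m 1 1)"
  have "four_block_mat (mat_diag m f) (0\<^sub>m m 1) (L * P) ?b = mat_diag (m + 1) ?g + ?N"
    using w' L by (intro eq_matI) (auto simp: mat_diag_def)
  moreover have "similar_mat (mat_diag (m + 1) ?g + ?N) (mat_diag (m + 1) ?g)"
    using w' L f by (intro similar_mat_diag_plus) (auto split: if_splits)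
  ultimately have s2: "similar_mat (four_block_mat B (0\<^sub>m m 1) L ?b) (mat_diag (m + 1) ?g)"
    using similar_mat_trans[OF s1] by simp
  show ?thesis
    unfolding diagonalizable_in_def using s2 f b B
    by (intro exI[of _ ?g]) auto
qed

text \<open>The first summand takes every other superdiagonal entry, ending with the last one; the second
  takes the remaining ones and the last row.\<close>

lemma sum_of_diagonalizable_in_bidiagonal_with_last_row:
  fixes H :: "'a :: field mat"
  assumes H: "H \<in> carrier_mat (Suc m) (Suc m)" and m: "0 < m"
    and S: "0 \<in> S" "1 \<in> S" "x \<in> S" "y \<in> S" "u \<in> S" "b \<in> S"
    and ne: "x \<noteq> y" "u \<noteq> 0" "b \<notin> {0, 1, u}"
    and av: "av = (\<lambda>i. if i = m then y else if Suc i = m then x else if odd (m - i) then 0 else 1)"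
    and bv: "bv = (\<lambda>i. if i = m then b else if Suc i = m then u else if odd (m - i) then 1 else 0)"
    and diag: "\<And>i. i \<le> m \<Longrightarrow> H $$ (i, i) = av i + bv i"
    and super: "\<And>i. i < m \<Longrightarrow> H $$ (i, Suc i) = 1"
    and zero: "\<And>i j. i < m \<Longrightarrow> j \<le> m \<Longrightarrow> j \<noteq> i \<Longrightarrow> j \<noteq> Suc i \<Longrightarrow> H $$ (i, j) = 0"
  shows "sum_of_diagonalizable_in S H"
proof -
  \<comment> \<open>Neither \<open>NA\<close> nor \<open>NB\<close> contains two consecutive
    superdiagonal ones, so \<open>similar_mat_diag_plus\<close> applies to both. A one of
    \<open>NA\<close> joins diagonal entries 0 and 1, or \<open>x\<close> and \<open>y\<close>; a
    one of \<open>NB\<close> joins 0 and 1, or 0 and \<open>u\<close>.\<close>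
  define NA where "NA = mat (Suc m) (Suc m) (\<lambda>(i, j). if j = Suc i \<and> odd (m - i) then 1 else 0 :: 'a)"
  define A where "A = mat_diag (Suc m) av + NA"
  define NB where "NB = mat m m (\<lambda>(i, j). if j = Suc i \<and> even (m - i) then 1 else 0 :: 'a)"
  define B1 where "B1 = mat_diag m bv + NB"
  define L where "L = mat 1 m (\<lambda>(i, j). H $$ (m, j))"
  define B where "B = four_block_mat B1 (0\<^sub>m m 1) L (mat_diag 1 (\<lambda>_. b))"
  have NA: "NA \<in> carrier_mat (Suc m) (Suc m)"
    by (simp add: NA_def)
  have A: "A \<in> carrier_mat (Suc m) (Suc m)"
    using NA by (simp add: A_def)
  have NB: "NB \<in> carrier_mat m m"
    by (simp add: NB_def)
  have B1: "B1 \<in> carrier_mat m m"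
    using NB by (simp add: B1_def)
  have L: "L \<in> carrier_mat 1 m"
    by (simp add: L_def)
  have B: "B \<in> carrier_mat (Suc m) (Suc m)"
    using four_block_carrier_mat[OF B1 mat_diag_dim[of 1 "\<lambda>_. b"]] by (simp add: B_def)
  have "similar_mat A (mat_diag (Suc m) av)"
    unfolding A_def
  proof (rule similar_mat_diag_plus[OF NA])
    fix i j assume "i < Suc m" "j < Suc m" "NA $$ (i, j) \<noteq> 0"
    then have j: "j = Suc i" "odd (m - i)" "i < m"
      by (auto simp: NA_def split: if_splits)
    then have "even (m - j)"
      by presburger
    then show "av i \<noteq> av j"
      using ne(1) j by (auto simp: av)
  next
    fix i j k assume "i < Suc m" "j < Suc m" "k < Suc m" "NA $$ (i, j) \<noteq> 0"
    then have j: "j = Suc i" "odd (m - i)" "i < m" "k < Suc m"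
      by (auto simp: NA_def split: if_splits)
    then have "even (m - j)"
      by presburger
    then show "NA $$ (j, k) = 0"
      using j by (simp add: NA_def)
  qed
  then have dA: "diagonalizable_in S A"
    unfolding diagonalizable_in_def using A S by (intro exI[of _ av]) (auto simp: av)
  have "similar_mat B1 (mat_diag m bv)"
    unfolding B1_def
  proof (rule similar_mat_diag_plus[OF NB])
    fix i j assume "i < m" "j < m" "NB $$ (i, j) \<noteq> 0"
    then have j: "j = Suc i" "even (m - i)" "j < m"
      by (auto simp: NB_def split: if_splits)
    then have "odd (m - j)"
      by presburger
    then show "bv i \<noteq> bv j"
      using ne(2) j by (auto simp: bv)
  next
    fix i j k assume "i < m" "j < m" "k < m" "NB $$ (i, j) \<noteq> 0"
    then have j: "j = Suc i" "even (m - i)" "j < m" "k < m"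
      by (auto simp: NB_def split: if_splits)
    then have "odd (m - j)"
      by presburger
    then show "NB $$ (j, k) = 0"
      using j by (simp add: NB_def)
  qed
  then have "diagonalizable_in (S - {b}) B1"
    unfolding diagonalizable_in_def using B1 S ne by (intro exI[of _ bv]) (auto simp: bv)
  then have dB: "diagonalizable_in S B"
    unfolding B_def using S B1 L by (intro diagonalizable_in_block_triangular) auto
  have "H = A + B"
  proof (rule eq_matI)
    fix i j assume "i < dim_row (A + B)" "j < dim_col (A + B)"
    then have ij: "i < Suc m" "j < Suc m"
      using B by auto
    have a: "A $$ (i, j) = (if i = j then av i else 0) + (if j = Suc i \<and> odd (m - i) then 1 else 0)"
      using ij by (simp add: A_def NA_def mat_diag_def)
    have b: "B $$ (i, j) = (if i < m then if j < m then (if i = j then bv i else 0) + (if j = Suc i \<and> even (m - i) then 1 else 0)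
        else 0 else if j < m then H $$ (m, j) else b)"
      using ij B1 by (auto simp: B_def B1_def NB_def L_def mat_diag_def)
    have last: "H $$ (m, m) = av m + b"
      using diag[of m] by (simp add: bv)
    \<comment> \<open>The last superdiagonal one must belong to \<open>A\<close>, as
      \<open>B\<close> has zeros above its corner entry.\<close>
    have odd1: "odd (m - i)" if "Suc i = m"
      using that by auto
    have "H $$ (i, j) = A $$ (i, j) + B $$ (i, j)"
    proof (cases "i = m")
      case True
      then show ?thesis
        unfolding a b using ij last by (auto simp: less_Suc_eq)
    next
      case False
      then have i: "i < m"
        using ij by simp
      consider "j = i" | "j = Suc i" "Suc i = m" | "j = Suc i" "Suc i < m" | "j \<noteq> i" "j \<noteq> Suc i"
        using i by linarith
      then show ?thesis
        unfolding a b by cases (use i ij diag[of i] super[of i] zero[of i j] odd1 in simp_all)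
    qed
    then show "H $$ (i, j) = (A + B) $$ (i, j)"
      using ij A B by simp
  qed (use H A B in auto)
  then show ?thesis
    unfolding sum_of_diagonalizable_in_def using H A B dA dB by auto
qed

section \<open>Traces\<close>

definition mat_trace :: "'a :: comm_monoid_add mat \<Rightarrow> 'a" where
  "mat_trace A = (\<Sum>i<dim_row A. A $$ (i, i))"

lemma mat_trace_mult_commute:
  fixes A :: "'a :: comm_semiring_0 mat"
  assumes "A \<in> carrier_mat n m" "B \<in> carrier_mat m n"
  shows "mat_trace (A * B) = mat_trace (B * A)"
proof -
  have "mat_trace (A * B) = (\<Sum>i<n. \<Sum>j<m. A $$ (i, j) * B $$ (j, i))"
    using assms by (auto simp: mat_trace_def scalar_prod_def lessThan_atLeast0 intro!: sum.cong)
  also have "\<dots> = (\<Sum>j<m. \<Sum>i<n. A $$ (i, j) * B $$ (j, i))"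
    by (rule sum.swap)
  also have "\<dots> = mat_trace (B * A)"
    using assms by (auto simp: mat_trace_def scalar_prod_def lessThan_atLeast0 mult.commute intro!: sum.cong)
  finally show ?thesis .
qed

lemma mat_trace_similar:
  fixes A :: "'a :: field mat"
  assumes "similar_mat A B"
  shows "mat_trace A = mat_trace B"
proof -
  obtain n P Q where c: "{A, B, P, Q} \<subseteq> carrier_mat n n" and PQ: "Q * P = 1\<^sub>m n"
    and A: "A = P * B * Q"
    using similar_matD[OF assms] by blast
  have "mat_trace A = mat_trace (Q * (P * B))"
    unfolding A using c by (intro mat_trace_mult_commute) auto
  also have "Q * (P * B) = B"
    using c PQ assoc_mult_mat[of Q n n P n B n] by auto
  finally show ?thesis .
qed

section \<open>Companion blocks\<close>

text \<open>The last row stays free: it holds the coefficients of the polynomial whose companion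
  matrix this is.\<close>

definition companion_like :: "'a :: field mat \<Rightarrow> bool" where
  "companion_like H \<longleftrightarrow>
     (\<forall>i j. Suc i < dim_row H \<longrightarrow> j < dim_row H \<longrightarrow> H $$ (i, j) = (if j = Suc i then 1 else 0))"

text \<open>Row \<open>i\<close> of the conjugating matrix is \<open>e\<^sub>0 (H - s\<^sub>0) \<cdots> (H - s\<^sub>i\<^sub>-\<^sub>1)\<close>.\<close>

fun shifted_row :: "(nat \<Rightarrow> 'a :: field) \<Rightarrow> nat \<Rightarrow> nat \<Rightarrow> 'a" where
  "shifted_row s 0 j = (if j = 0 then 1 else 0)"
| "shifted_row s (Suc i) j = (if j = 0 then 0 else shifted_row s i (j - 1)) - s i * shifted_row s i j"

lemma shifted_row_above: "i < j \<Longrightarrow> shifted_row s i j = 0"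
  by (induction i arbitrary: j) auto

lemma shifted_row_diag: "shifted_row s i i = 1"
  by (induction i) (auto simp: shifted_row_above)

lemma lower_unitriangular_inverse:
  fixes P :: "'a :: field mat"
  assumes P: "P \<in> carrier_mat n n"
    and zero: "\<And>i j. i < j \<Longrightarrow> j < n \<Longrightarrow> P $$ (i, j) = 0"
    and one: "\<And>i. i < n \<Longrightarrow> P $$ (i, i) = 1"
  obtains Q where "Q \<in> carrier_mat n n" "P * Q = 1\<^sub>m n" "Q * P = 1\<^sub>m n"
proof -
  have "det P = prod_list (diag_mat P)"
    by (rule det_lower_triangular[OF zero P])
  also have "\<dots> = 1"
    using P one by (simp add: prod_list_diag_prod)
  finally have "det P = 1" .
  moreover have "1 \<cdot>\<^sub>m 1\<^sub>m n = (1\<^sub>m n :: 'a mat)"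
    by (rule eq_matI) auto
  ultimately show thesis
    using that[of "adj_mat P"] adj_mat[OF P] by simp
qed

text \<open>The rows of \<open>P\<close> satisfy
  \<open>row i * H = s i * row i + row (i + 1)\<close> for \<open>i < m\<close>, so in this basis
  all rows but the last are bidiagonal with diagonal \<open>s\<close>. The last diagonal entry is
  then forced by the trace.\<close>

lemma companion_like_similar_prescribed_diagonal:
  fixes H :: "'a :: field mat" and s :: "nat \<Rightarrow> 'a"
  assumes H: "H \<in> carrier_mat (Suc m) (Suc m)" and comp: "companion_like H"
    and tr: "mat_trace H = (\<Sum>i<Suc m. s i)"
  obtains H' where "similar_mat H H'" "H' \<in> carrier_mat (Suc m) (Suc m)"
    "\<And>i. i \<le> m \<Longrightarrow> H' $$ (i, i) = s i" "\<And>i. i < m \<Longrightarrow> H' $$ (i, Suc i) = 1"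
    "\<And>i j. i < m \<Longrightarrow> j \<le> m \<Longrightarrow> j \<noteq> i \<Longrightarrow> j \<noteq> Suc i \<Longrightarrow> H' $$ (i, j) = 0"
proof -
  define P where "P = mat (Suc m) (Suc m) (\<lambda>(i, j). shifted_row s i j)"
  have P: "P \<in> carrier_mat (Suc m) (Suc m)"
    by (simp add: P_def)
  obtain Q where Q: "Q \<in> carrier_mat (Suc m) (Suc m)"
    and PQ: "P * Q = 1\<^sub>m (Suc m)" "Q * P = 1\<^sub>m (Suc m)"
    by (rule lower_unitriangular_inverse[OF P]) (auto simp: P_def shifted_row_above shifted_row_diag)
  define H' where "H' = P * H * Q"
  have H': "H' \<in> carrier_mat (Suc m) (Suc m)"
    using P Q H by (simp add: H'_def)
  have "similar_mat H' H"
    using P Q H H' PQ by (intro similar_matI[of _ _ P Q]) (auto simp: H'_def)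
  then have sim: "similar_mat H H'"
    by (rule similar_mat_sym)
  have PH: "(P * H) $$ (i, j) = s i * P $$ (i, j) + P $$ (Suc i, j)" if i: "i < m" and j: "j \<le> m" for i j
  proof -
    have "(P * H) $$ (i, j) = (\<Sum>k<Suc m. P $$ (i, k) * H $$ (k, j))"
      using i j P H by (auto simp: scalar_prod_def lessThan_atLeast0)
    also have "\<dots> = (\<Sum>k<Suc m. if Suc k = j then shifted_row s i k else 0)"
    proof (rule sum.cong)
      fix k assume k: "k \<in> {..<Suc m}"
      show "P $$ (i, k) * H $$ (k, j) = (if Suc k = j then shifted_row s i k else 0)"
      \<comment> \<open>The last row of \<open>H\<close> is unknown, but its coefficient lies above
        the diagonal of \<open>P\<close> and vanishes.\<close>
      proof (cases "k = m")
        case True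
        then show ?thesis
          using i j by (simp add: P_def shifted_row_above)
      next
        case False
        then show ?thesis
          using i j k H comp by (auto simp: companion_like_def P_def)
      qed
    qed simp
    also have "\<dots> = (if j = 0 then 0 else shifted_row s i (j - 1))"
      using j by (cases j) (auto simp: sum.delta')
    also have "\<dots> = s i * P $$ (i, j) + P $$ (Suc i, j)"
      using i j by (simp add: P_def)
    finally show ?thesis .
  qed
  have row: "H' $$ (i, j) = s i * (if i = j then 1 else 0) + (if j = Suc i then 1 else 0)"
    if i: "i < m" and j: "j \<le> m" for i j
  proof -
    have "H' $$ (i, j) = (\<Sum>k<Suc m. (P * H) $$ (i, k) * Q $$ (k, j))"
      unfolding H'_def using i j P H Q by (subst index_mult_mat) (auto simp: scalar_prod_def lessThan_atLeast0)
    also have "\<dots> = (\<Sum>k<Suc m. s i * (P $$ (i, k) * Q $$ (k, j)) + P $$ (Suc i, k) * Q $$ (k, j))"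
      by (rule sum.cong) (use i in \<open>auto simp: PH algebra_simps\<close>)
    also have "\<dots> = s i * (\<Sum>k<Suc m. P $$ (i, k) * Q $$ (k, j)) + (\<Sum>k<Suc m. P $$ (Suc i, k) * Q $$ (k, j))"
      by (simp only: sum.distrib sum_distrib_left)
    also have "(\<Sum>k<Suc m. P $$ (i, k) * Q $$ (k, j)) = (P * Q) $$ (i, j)"
      using i j P Q by (auto simp: scalar_prod_def lessThan_atLeast0)
    also have "(\<Sum>k<Suc m. P $$ (Suc i, k) * Q $$ (k, j)) = (P * Q) $$ (Suc i, j)"
      using i j P Q by (auto simp: scalar_prod_def lessThan_atLeast0)
    finally show ?thesis
      unfolding PQ using i j by auto
  qed
  have "(\<Sum>i<Suc m. s i) = (\<Sum>i<Suc m. H' $$ (i, i))"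
    using mat_trace_similar[OF sim] tr H' by (simp add: mat_trace_def)
  also have "\<dots> = (\<Sum>i<m. s i) + H' $$ (m, m)"
    by (simp add: row)
  finally have last: "H' $$ (m, m) = s m"
    by simp
  show thesis
  proof (rule that[OF sim H'])
    show "H' $$ (i, i) = s i" if "i \<le> m" for i
      using that last row[of i i] by (cases "i = m") auto
  qed (auto simp: row)
qed

lemma sum_of_diagonalizable_in_companion_like:
  fixes H :: "'a :: field mat"
  assumes H: "H \<in> carrier_mat r r" and r: "0 < r" and comp: "companion_like H"
    and two: "\<And>c. \<exists>x\<in>S. \<exists>y\<in>S. c = x + y"
    and S: "0 \<in> S" "1 \<in> S" "finite S" "6 \<le> card S"
  shows "sum_of_diagonalizable_in S H"
proof -
  obtain m where m: "r = Suc m"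
    using r by (cases r) auto
  show ?thesis
  proof (cases "m = 0")
    case True
    obtain x y where xy: "x \<in> S" "y \<in> S" "H $$ (0, 0) = x + y"
      using two by blast
    have d: "diagonalizable_in S (mat_diag 1 (\<lambda>_. z))" if "z \<in> S" for z
      unfolding diagonalizable_in_def using that similar_mat_refl[OF mat_diag_dim]
      by (intro exI[of _ "\<lambda>_. z"]) simp
    have "H = mat_diag 1 (\<lambda>_. x) + mat_diag 1 (\<lambda>_. y)"
      using H m True xy by (intro eq_matI) (auto simp: mat_diag_def)
    moreover have "dim_row H = 1"
      using H m True by simp
    ultimately show ?thesis
      unfolding sum_of_diagonalizable_in_def using d[OF xy(1)] d[OF xy(2)] mat_diag_dim by metis
  next
    case False
    \<comment> \<open>The alternating part of the diagonals is fixed before \<open>u\<close>,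
      \<open>b\<close>, \<open>x\<close>, \<open>y\<close> are known; \<open>c\<close> is its share
      of the trace, and the four values must supply the rest.\<close>
    define f where "f = (\<lambda>i. if odd (m - i) then 0 else 1 :: 'a)"
    define g where "g = (\<lambda>i. if odd (m - i) then 1 else 0 :: 'a)"
    define c where "c = (\<Sum>i<m - 1. f i + g i)"
    obtain u b x y where w: "u \<in> S" "b \<in> S" "x \<in> S" "y \<in> S" "u \<noteq> 0" "b \<notin> {0, 1, u}" "x \<noteq> y"
      and t: "mat_trace H - c = u + b + x + y"
      using exists_sum_of_four_distinct[OF two S, of "mat_trace H - c"] by blast
    define av where "av = (\<lambda>i. if i = m then y else if Suc i = m then x else if odd (m - i) then 0 else 1)"
    define bv where "bv = (\<lambda>i. if i = m then b else if Suc i = m then u else if odd (m - i) then 1 else 0)"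
    obtain l where l: "m = Suc l"
      using False by (cases m) auto
    have "(\<Sum>i<l. av i + bv i) = c"
      unfolding c_def using l by (intro sum.cong) (auto simp: av_def bv_def f_def g_def)
    then have "(\<Sum>i<Suc m. av i + bv i) = c + (x + u) + (y + b)"
      using l by (simp add: av_def bv_def)
    then have tr: "mat_trace H = (\<Sum>i<Suc m. av i + bv i)"
      using t by (simp add: algebra_simps)
    obtain H' where H': "similar_mat H H'" "H' \<in> carrier_mat (Suc m) (Suc m)"
      "\<And>i. i \<le> m \<Longrightarrow> H' $$ (i, i) = av i + bv i" "\<And>i. i < m \<Longrightarrow> H' $$ (i, Suc i) = 1"
      "\<And>i j. i < m \<Longrightarrow> j \<le> m \<Longrightarrow> j \<noteq> i \<Longrightarrow> j \<noteq> Suc i \<Longrightarrow> H' $$ (i, j) = 0"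
      using companion_like_similar_prescribed_diagonal[OF H[unfolded m] comp tr] by metis
    have "sum_of_diagonalizable_in S H'"
      by (rule sum_of_diagonalizable_in_bidiagonal_with_last_row[OF H'(2) _ S(1,2) w(3,4,1,2) w(7,5,6) av_def bv_def H'(3-5)])
        (use False in auto)
    then show ?thesis
      by (rule sum_of_diagonalizable_in_similar[OF H'(1)])
  qed
qed

section \<open>Splitting off a cyclic block\<close>

lemma index_mult_mat_sum:
  assumes "A \<in> carrier_mat a b" "B \<in> carrier_mat b c" "i < a" "j < c"
  shows "(A * B) $$ (i, j) = (\<Sum>k<b. A $$ (i, k) * B $$ (k, j))"
  using assms by (auto simp: scalar_prod_def lessThan_atLeast0)

lemma index_mult_mat_cong:
  assumes "A \<in> carrier_mat a b" "B \<in> carrier_mat b c" "i < a" "j < c"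
    and "A' \<in> carrier_mat a' b" "B' \<in> carrier_mat b c'" "i' < a'" "j' < c'"
    and "\<And>k. k < b \<Longrightarrow> A $$ (i, k) = A' $$ (i', k)"
    and "\<And>k. k < b \<Longrightarrow> B $$ (k, j) = B' $$ (k, j')"
  shows "(A * B) $$ (i, j) = (A' * B') $$ (i', j')"
  unfolding index_mult_mat_sum[OF assms(1-4)] index_mult_mat_sum[OF assms(5-8)]
  using assms(9,10) by simp

text \<open>Otherwise padding both matrices with zeros to size \<open>n\<close> gives a right
  inverse, hence a two-sided one; but row \<open>r\<close> of the padded \<open>B\<close> is
  zero.\<close>

lemma dim_le_of_right_inverse:
  fixes A :: "'a :: field mat"
  assumes A: "A \<in> carrier_mat n r" and B: "B \<in> carrier_mat r n" and AB: "A * B = 1\<^sub>m n"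
  shows "n \<le> r"
proof (rule ccontr)
  assume "\<not> n \<le> r"
  then have r: "r < n"
    by simp
  define A' where "A' = mat n n (\<lambda>(i, j). if j < r then A $$ (i, j) else 0)"
  define B' where "B' = mat n n (\<lambda>(i, j). if i < r then B $$ (i, j) else 0)"
  have c: "A' \<in> carrier_mat n n" "B' \<in> carrier_mat n n"
    by (auto simp: A'_def B'_def)
  have "A' * B' = 1\<^sub>m n"
  proof (rule eq_matI)
    fix i j assume "i < dim_row (1\<^sub>m n :: 'a mat)" "j < dim_col (1\<^sub>m n :: 'a mat)"
    then have ij: "i < n" "j < n"
      by auto
    have "(A' * B') $$ (i, j) = (\<Sum>k<n. A' $$ (i, k) * B' $$ (k, j))"
      by (rule index_mult_mat_sum[OF c ij])
    also have "\<dots> = (\<Sum>k<r. A $$ (i, k) * B $$ (k, j))"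
      using r ij by (intro sum.mono_neutral_cong_right) (auto simp: A'_def B'_def)
    also have "\<dots> = (A * B) $$ (i, j)"
      by (rule index_mult_mat_sum[OF A B ij, symmetric])
    finally show "(A' * B') $$ (i, j) = 1\<^sub>m n $$ (i, j)"
      unfolding AB .
  qed (use c in auto)
  then have "B' * A' = 1\<^sub>m n"
    by (rule mat_mult_left_right_inverse[OF c])
  then have "(B' * A') $$ (r, r) = 1"
    using r by simp
  moreover have "(B' * A') $$ (r, r) = 0"
    unfolding index_mult_mat_sum[OF c(2,1) r r] using r by (intro sum.neutral) (auto simp: B'_def)
  ultimately show False
    by simp
qed

text \<open>If \<open>E = 1 - X Y\<close> has a nonzero entry \<open>(k, l)\<close>, then column \<open>l\<close> and the normalised row \<open>k\<close> of the
  idempotent \<open>E\<close> extend the two biorthogonal systems.\<close>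

lemma biorthogonal_completion:
  fixes X Y :: "'a :: field mat"
  assumes "Y \<in> carrier_mat r n" "X \<in> carrier_mat n r" "Y * X = 1\<^sub>m r"
  shows "\<exists>P Q. P \<in> carrier_mat n n \<and> Q \<in> carrier_mat n n \<and> P * Q = 1\<^sub>m n \<and> Q * P = 1\<^sub>m n \<and>
    (\<forall>i<n. \<forall>j<r. P $$ (i, j) = X $$ (i, j)) \<and> (\<forall>i<r. \<forall>j<n. Q $$ (i, j) = Y $$ (i, j))"
  using assms
proof (induction "n - r" arbitrary: r X Y)
  case 0
  have "r \<le> n"
    by (rule dim_le_of_right_inverse[OF "0.prems"])
  then have "r = n"
    using "0.hyps" by simp
  then show ?case
    using "0.prems" mat_mult_left_right_inverse[of Y n X] by blast
next
  case (Suc t)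
  note Y = Suc.prems(1) and X = Suc.prems(2) and YX = Suc.prems(3)
  have rn: "r < n"
    using Suc.hyps(2) by simp
  define E where "E = 1\<^sub>m n - X * Y"
  have XY: "X * Y \<in> carrier_mat n n"
    using X Y by simp
  have E: "E \<in> carrier_mat n n"
    unfolding E_def using XY by (rule minus_carrier_mat)
  have YE: "Y * E = 0\<^sub>m r n"
  proof -
    have "Y * E = Y * 1\<^sub>m n - Y * (X * Y)"
      unfolding E_def using Y XY by (intro mult_minus_distrib_mat) auto
    also have "Y * (X * Y) = Y"
      using assoc_mult_mat[OF Y X Y] YX Y by simp
    finally show ?thesis
      using Y by simp
  qed
  have EX: "E * X = 0\<^sub>m n r"
  proof -
    have "E * X = 1\<^sub>m n * X - X * Y * X"
      unfolding E_def using X XY by (intro minus_mult_distrib_mat) auto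
    also have "X * Y * X = X"
      using assoc_mult_mat[OF X Y X] YX X by simp
    finally show ?thesis
      using X by simp
  qed
  have EE: "E * E = E"
  proof -
    have "E * E = E * 1\<^sub>m n - E * (X * Y)"
      by (subst (2) E_def) (use E XY in \<open>intro mult_minus_distrib_mat, auto\<close>)
    also have "E * (X * Y) = 0\<^sub>m n n"
      using assoc_mult_mat[OF E X Y] EX Y by simp
    finally show ?thesis
      using E by (auto intro!: eq_matI)
  qed
  \<comment> \<open>If \<open>E\<close> were zero, then \<open>X * Y = 1\<close> and the dimension
    bound would give \<open>n \<le> r\<close>.\<close>
  have "\<exists>k<n. \<exists>l<n. E $$ (k, l) \<noteq> 0"
  proof (rule ccontr)
    assume neg: "\<not> ?thesis"
    have "X * Y = 1\<^sub>m n"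
    proof (rule eq_matI)
      fix i j assume "i < dim_row (1\<^sub>m n :: 'a mat)" "j < dim_col (1\<^sub>m n :: 'a mat)"
      then have ij: "i < n" "j < n"
        by auto
      then have "E $$ (i, j) = 0"
        using neg by blast
      moreover have "E $$ (i, j) = 1\<^sub>m n $$ (i, j) - (X * Y) $$ (i, j)"
        unfolding E_def by (rule index_minus_mat(1)) (use ij X Y in auto)
      ultimately show "(X * Y) $$ (i, j) = 1\<^sub>m n $$ (i, j)"
        by (metis eq_iff_diff_eq_0)
    qed (use X Y in auto)
    then show False
      using dim_le_of_right_inverse[OF X Y] rn by simp
  qed
  then obtain k l where kl: "k < n" "l < n" "E $$ (k, l) \<noteq> 0"
    by blast
  define e where "e = E $$ (k, l)"
  define X' where "X' = mat n (Suc r) (\<lambda>(i, j). if j < r then X $$ (i, j) else E $$ (i, l))"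
  define Y' where "Y' = mat (Suc r) n (\<lambda>(i, j). if i < r then Y $$ (i, j) else E $$ (k, j) / e)"
  have X': "X' \<in> carrier_mat n (Suc r)" and Y': "Y' \<in> carrier_mat (Suc r) n"
    by (auto simp: X'_def Y'_def)
  have "Y' * X' = 1\<^sub>m (Suc r)"
  proof (rule eq_matI)
    fix i j assume "i < dim_row (1\<^sub>m (Suc r) :: 'a mat)" "j < dim_col (1\<^sub>m (Suc r) :: 'a mat)"
    then have ij: "i < Suc r" "j < Suc r"
      by auto
    have *: "(Y' * X') $$ (i, j) = (\<Sum>a<n. Y' $$ (i, a) * X' $$ (a, j))"
      by (rule index_mult_mat_sum[OF Y' X' ij])
    consider "i < r" "j < r" | "i < r" "j = r" | "i = r" "j < r" | "i = r" "j = r"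
      using ij by linarith
    then show "(Y' * X') $$ (i, j) = 1\<^sub>m (Suc r) $$ (i, j)"
    proof cases
      case 1
      have "(Y' * X') $$ (i, j) = (\<Sum>a<n. Y $$ (i, a) * X $$ (a, j))"
        unfolding * using 1 by (intro sum.cong) (auto simp: Y'_def X'_def)
      also have "\<dots> = (Y * X) $$ (i, j)"
        by (rule index_mult_mat_sum[OF Y X 1, symmetric])
      finally show ?thesis
        using 1 YX by simp
    next
      case 2
      have "(Y' * X') $$ (i, j) = (\<Sum>a<n. Y $$ (i, a) * E $$ (a, l))"
        unfolding * using 2 by (intro sum.cong) (auto simp: Y'_def X'_def)
      also have "\<dots> = (Y * E) $$ (i, l)"
        by (rule index_mult_mat_sum[OF Y E 2(1) kl(2), symmetric])
      finally show ?thesis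
        using 2 YE kl by simp
    next
      case 3
      have "(Y' * X') $$ (i, j) = (\<Sum>a<n. E $$ (k, a) * X $$ (a, j)) / e"
        unfolding * sum_divide_distrib using 3 by (intro sum.cong) (auto simp: Y'_def X'_def)
      also have "\<dots> = (E * X) $$ (k, j) / e"
        by (simp only: index_mult_mat_sum[OF E X kl(1) 3(2)])
      finally show ?thesis
        using 3 EX kl by simp
    next
      case 4
      have "(Y' * X') $$ (i, j) = (\<Sum>a<n. E $$ (k, a) * E $$ (a, l)) / e"
        unfolding * sum_divide_distrib using 4 by (intro sum.cong) (auto simp: Y'_def X'_def)
      also have "\<dots> = (E * E) $$ (k, l) / e"
        by (simp only: index_mult_mat_sum[OF E E kl(1,2)])
      also have "\<dots> = 1"
        unfolding EE e_def using kl by simp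
      finally show ?thesis
        using 4 by simp
    qed
  qed (use X' Y' in auto)
  moreover have "t = n - Suc r"
    using Suc.hyps(2) by simp
  ultimately obtain P Q where PQ: "P \<in> carrier_mat n n" "Q \<in> carrier_mat n n" "P * Q = 1\<^sub>m n" "Q * P = 1\<^sub>m n"
    and P: "\<forall>i<n. \<forall>j<Suc r. P $$ (i, j) = X' $$ (i, j)"
    and Q: "\<forall>i<Suc r. \<forall>j<n. Q $$ (i, j) = Y' $$ (i, j)"
    using Suc.hyps(1)[OF _ Y' X'] by blast
  have "\<forall>i<n. \<forall>j<r. P $$ (i, j) = X $$ (i, j)" "\<forall>i<r. \<forall>j<n. Q $$ (i, j) = Y $$ (i, j)"
    using P Q by (auto simp: X'_def Y'_def)
  then show ?case
    using PQ by blast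
qed

section \<open>Krylov sequences\<close>

lemma pow_mat_add:
  assumes "M \<in> carrier_mat n n"
  shows "M ^\<^sub>m (i + j) = M ^\<^sub>m i * M ^\<^sub>m j"
proof (induction j)
  case 0
  then show ?case
    using assms by simp
next
  case (Suc j)
  have "M ^\<^sub>m (i + Suc j) = M ^\<^sub>m i * M ^\<^sub>m j * M"
    using Suc by simp
  also have "\<dots> = M ^\<^sub>m i * (M ^\<^sub>m j * M)"
    by (rule assoc_mult_mat[of _ n n _ n _ n]) (use assms in auto)
  finally show ?case
    by simp
qed

text \<open>Functional and vector are one-row and one-column matrices, so that associativity of the
  matrix product covers all cases; the scalar is read off a 1 by 1 matrix.\<close>

definition krylov :: "'a :: field mat \<Rightarrow> 'a mat \<Rightarrow> 'a mat \<Rightarrow> nat \<Rightarrow> 'a" where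
  "krylov M F W i = (F * M ^\<^sub>m i * W) $$ (0, 0)"

lemma krylov_add:
  assumes "M \<in> carrier_mat n n" "F \<in> carrier_mat 1 n" "W \<in> carrier_mat n 1"
  shows "krylov M F W (i + j) = ((F * M ^\<^sub>m i) * (M ^\<^sub>m j * W)) $$ (0, 0)"
proof -
  have "F * M ^\<^sub>m (i + j) * W = F * M ^\<^sub>m i * M ^\<^sub>m j * W"
    unfolding pow_mat_add[OF assms(1)]
    using assms by (simp add: assoc_mult_mat[of F 1 n "M ^\<^sub>m i" n "M ^\<^sub>m j" n])
  also have "\<dots> = (F * M ^\<^sub>m i) * (M ^\<^sub>m j * W)"
    by (rule assoc_mult_mat[of _ 1 n _ n _ 1]) (use assms in auto)
  finally show ?thesis
    by (simp add: krylov_def)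
qed

text \<open>\<open>Y\<close> stacks the rows \<open>F * M ^ i\<close>, while \<open>V\<close> lists
  the columns \<open>M ^ j * W\<close> in reversed order. Entry \<open>(i, j)\<close> of
  \<open>Y * V\<close> is therefore the Krylov value at \<open>i + (m - j)\<close>, which makes
  \<open>Y * V\<close> lower unitriangular and thus invertible.\<close>

lemma krylov_biorthogonal:
  fixes M :: "'a :: field mat"
  assumes M: "M \<in> carrier_mat n n" and F: "F \<in> carrier_mat 1 n" and W: "W \<in> carrier_mat n 1"
    and zero: "\<And>i. i < m \<Longrightarrow> krylov M F W i = 0" and one: "krylov M F W m = 1"
  obtains Y V Z where "Y \<in> carrier_mat (Suc m) n" "V \<in> carrier_mat n (Suc m)" "Z \<in> carrier_mat (Suc m) (Suc m)"
    "Y * V * Z = 1\<^sub>m (Suc m)" "Z * (Y * V) = 1\<^sub>m (Suc m)"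
    "\<And>A c i j. A \<in> carrier_mat n c \<Longrightarrow> i < Suc m \<Longrightarrow> j < c \<Longrightarrow> (Y * A) $$ (i, j) = (F * M ^\<^sub>m i * A) $$ (0, j)"
    "\<And>A a i j. A \<in> carrier_mat a n \<Longrightarrow> i < a \<Longrightarrow> j < Suc m \<Longrightarrow>
      (A * V) $$ (i, j) = (A * (M ^\<^sub>m (m - j) * W)) $$ (i, 0)"
proof -
  define r where "r = Suc m"
  define Y where "Y = mat r n (\<lambda>(i, j). (F * M ^\<^sub>m i) $$ (0, j))"
  define V where "V = mat n r (\<lambda>(i, j). (M ^\<^sub>m (m - j) * W) $$ (i, 0))"
  have Y: "Y \<in> carrier_mat r n" and V: "V \<in> carrier_mat n r"
    by (auto simp: Y_def V_def)
  have FM: "F * M ^\<^sub>m i \<in> carrier_mat 1 n" and MW: "M ^\<^sub>m i * W \<in> carrier_mat n 1" for i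
    using F M W by auto
  have FMA: "(Y * A) $$ (i, j) = (F * M ^\<^sub>m i * A) $$ (0, j)"
    if "A \<in> carrier_mat n c" "i < r" "j < c" for A i j c
    by (rule index_mult_mat_cong[OF Y that FM that(1) _ that(3)]) (use that in \<open>auto simp: Y_def\<close>)
  have AMW: "(A * V) $$ (i, j) = (A * (M ^\<^sub>m (m - j) * W)) $$ (i, 0)"
    if "A \<in> carrier_mat a n" "i < a" "j < r" for A i j a
    by (rule index_mult_mat_cong[OF that(1) V that(2,3) that(1) MW that(2)]) (use that in \<open>auto simp: V_def\<close>)
  have YV: "(Y * V) $$ (i, j) = krylov M F W (i + (m - j))" if "i < r" "j < r" for i j
    unfolding FMA[OF V that] krylov_add[OF M F W] by (rule AMW[OF FM _ that(2)]) simp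
  have YVc: "Y * V \<in> carrier_mat r r"
    using Y V by simp
  obtain Z where Z: "Z \<in> carrier_mat r r" and YVZ: "Y * V * Z = 1\<^sub>m r" "Z * (Y * V) = 1\<^sub>m r"
  proof (rule lower_unitriangular_inverse[OF YVc])
    show "(Y * V) $$ (i, j) = 0" if "i < j" "j < r" for i j
      using that by (subst YV) (auto simp: r_def intro!: zero)
    show "(Y * V) $$ (i, i) = 1" if "i < r" for i
      using that one by (subst YV) (auto simp: r_def)
  qed
  show thesis
    by (rule that[OF Y[unfolded r_def] V[unfolded r_def] Z[unfolded r_def] YVZ[unfolded r_def]
          FMA[unfolded r_def] AMW[unfolded r_def]])
qed

lemma krylov_length_less_dim:
  fixes M :: "'a :: field mat"
  assumes M: "M \<in> carrier_mat n n" and F: "F \<in> carrier_mat 1 n" and W: "W \<in> carrier_mat n 1"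
    and zero: "\<And>i. i < m \<Longrightarrow> krylov M F W i = 0" and one: "krylov M F W m = 1"
  shows "m < n"
proof (rule krylov_biorthogonal[OF M F W _ one])
  fix Y V Z :: "'a mat"
  assume Y: "Y \<in> carrier_mat (Suc m) n" and V: "V \<in> carrier_mat n (Suc m)"
    and Z: "Z \<in> carrier_mat (Suc m) (Suc m)" and YVZ: "Y * V * Z = 1\<^sub>m (Suc m)"
  have "Y * (V * Z) = 1\<^sub>m (Suc m)"
    using assoc_mult_mat[OF Y V Z] YVZ by simp
  then have "Suc m \<le> n"
    by (rule dim_le_of_right_inverse[OF Y mult_carrier_mat[OF V Z]])
  then show ?thesis
    by simp
qed (rule zero)

text \<open>Maximality of the length of a Krylov pair makes both the span of the vectors and the common kernel
  of the functionals invariant, so that the cyclic block splits off.\<close>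

lemma cyclic_block_splits_off:
  fixes M :: "'a :: field mat"
  assumes M: "M \<in> carrier_mat n n" and F: "F \<in> carrier_mat 1 n" and W: "W \<in> carrier_mat n 1"
    and zero: "\<And>i. i < m \<Longrightarrow> krylov M F W i = 0" and one: "krylov M F W m = 1"
    and max: "\<And>G C. G \<in> carrier_mat 1 n \<Longrightarrow> C \<in> carrier_mat n 1 \<Longrightarrow>
      \<forall>i\<le>m. krylov M G C i = 0 \<Longrightarrow> krylov M G C (Suc m) = 0"
  shows "\<exists>H M' t. n = Suc m + t \<and> H \<in> carrier_mat (Suc m) (Suc m) \<and> M' \<in> carrier_mat t t \<and>
    companion_like H \<and> similar_mat M (four_block_mat H (0\<^sub>m (Suc m) t) (0\<^sub>m t (Suc m)) M')"
proof -
  define r where "r = Suc m"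
  obtain Y V Z where Y: "Y \<in> carrier_mat r n" and V: "V \<in> carrier_mat n r" and Z: "Z \<in> carrier_mat r r"
    and YVZ: "Y * V * Z = 1\<^sub>m r" "Z * (Y * V) = 1\<^sub>m r"
    and FMA: "\<And>A c i j. A \<in> carrier_mat n c \<Longrightarrow> i < r \<Longrightarrow> j < c \<Longrightarrow> (Y * A) $$ (i, j) = (F * M ^\<^sub>m i * A) $$ (0, j)"
    and AMW: "\<And>A a i j. A \<in> carrier_mat a n \<Longrightarrow> i < a \<Longrightarrow> j < r \<Longrightarrow>
      (A * V) $$ (i, j) = (A * (M ^\<^sub>m (m - j) * W)) $$ (i, 0)"
    using krylov_biorthogonal[OF M F W zero one] unfolding r_def by metis
  have FM: "F * M ^\<^sub>m i \<in> carrier_mat 1 n" for i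
    using F M by auto
  have YVc: "Y * V \<in> carrier_mat r r"
    using Y V by simp
  define X where "X = V * Z"
  have X: "X \<in> carrier_mat n r"
    using V Z by (simp add: X_def)
  have YX: "Y * X = 1\<^sub>m r"
    unfolding X_def using assoc_mult_mat[OF Y V Z] YVZ by simp
  have VX: "V = X * (Y * V)"
    unfolding X_def using assoc_mult_mat[OF V Z YVc] YVZ V by simp
  have rn: "r \<le> n"
    by (rule dim_le_of_right_inverse[OF Y X YX])
  \<comment> \<open>The first \<open>r\<close> columns of \<open>P\<close> span the Krylov space,
    and the remaining ones lie in the common kernel of the rows of \<open>Y\<close>.\<close>
  obtain P Q where P: "P \<in> carrier_mat n n" and Q: "Q \<in> carrier_mat n n"
    and PQ: "P * Q = 1\<^sub>m n" "Q * P = 1\<^sub>m n"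
    and PX: "\<And>i j. i < n \<Longrightarrow> j < r \<Longrightarrow> P $$ (i, j) = X $$ (i, j)"
    and QY: "\<And>i j. i < r \<Longrightarrow> j < n \<Longrightarrow> Q $$ (i, j) = Y $$ (i, j)"
    using biorthogonal_completion[OF Y X YX] by blast
  define K where "K = Q * M * P"
  have K: "K \<in> carrier_mat n n"
    using P Q M by (simp add: K_def)
  have MP: "M * P \<in> carrier_mat n n" and QM: "Q * M \<in> carrier_mat n n"
    using P Q M by auto
  have sim: "similar_mat M K"
  proof (rule similar_mat_sym, rule similar_matI[of _ _ Q P n])
    show "K = Q * M * P"
      by (simp add: K_def)
  qed (use P Q M K PQ in auto)
  have K': "K = Q * (M * P)"
    unfolding K_def by (rule assoc_mult_mat[OF Q M P])
  have step: "F * M ^\<^sub>m i * (M * A) = F * M ^\<^sub>m Suc i * A" if A: "A \<in> carrier_mat n c" for A i c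
  proof -
    have "F * M ^\<^sub>m Suc i = F * M ^\<^sub>m i * M"
      using F M by (simp add: assoc_mult_mat[of F 1 n "M ^\<^sub>m i" n M n])
    then show ?thesis
      using assoc_mult_mat[OF FM M A] by simp
  qed
  have QA: "(Q * A) $$ (i, j) = (F * M ^\<^sub>m i * A) $$ (0, j)"
    if "A \<in> carrier_mat n c" "i < r" "j < c" for A i j c
  proof -
    have "(Q * A) $$ (i, j) = (Y * A) $$ (i, j)"
      by (rule index_mult_mat_cong[OF Q that(1) _ that(3) Y that]) (use that rn QY in auto)
    then show ?thesis
      using FMA[OF that] by simp
  qed
  \<comment> \<open>Row \<open>i\<close> of \<open>Q * M\<close> is row \<open>i + 1\<close> of
    \<open>Q\<close>, and \<open>Q * P = 1\<close>.\<close>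
  have top: "K $$ (i, j) = (if j = Suc i then 1 else 0)" if "i < m" "j < n" for i j
  proof -
    have i: "i < r" "Suc i < r" "Suc i < n"
      using that rn by (auto simp: r_def)
    have "K $$ (i, j) = (F * M ^\<^sub>m Suc i * P) $$ (0, j)"
      unfolding K' QA[OF MP i(1) that(2)] step[OF P] ..
    also have "\<dots> = (Q * P) $$ (Suc i, j)"
      using QA[OF P i(2) that(2)] by simp
    finally show ?thesis
      unfolding PQ using that i by simp
  qed
  \<comment> \<open>Column \<open>j\<close> of \<open>P\<close> is killed by
    \<open>F * M ^ i\<close> for all \<open>i \<le> m\<close>, so by maximality also by the next
    functional.\<close>
  have topright: "K $$ (m, j) = 0" if j: "r \<le> j" "j < n" for j
  proof -
    define C where "C = mat n 1 (\<lambda>(i, _). P $$ (i, j))"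
    have C: "C \<in> carrier_mat n 1"
      by (simp add: C_def)
    have AC: "(A * C) $$ (i, 0) = (A * P) $$ (i, j)" if "A \<in> carrier_mat a n" "i < a" for A a i
      by (rule index_mult_mat_cong[OF that(1) C that(2) _ that(1) P that(2) j(2)]) (auto simp: C_def)
    have "krylov M F C i = 0" if "i \<le> m" for i
    proof -
      have i: "i < r" "i < n"
        using that rn by (auto simp: r_def)
      have "krylov M F C i = (F * M ^\<^sub>m i * P) $$ (0, j)"
        unfolding krylov_def by (rule AC[OF FM]) simp
      also have "\<dots> = (Q * P) $$ (i, j)"
        using QA[OF P i(1) j(2)] by simp
      finally show ?thesis
        unfolding PQ using i j by simp
    qed
    then have "krylov M F C (Suc m) = 0"
      using max[OF F C] by blast
    then have "(F * M ^\<^sub>m Suc m * P) $$ (0, j) = 0"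
      unfolding krylov_def using AC[OF FM[of "Suc m"]] by simp
    then show ?thesis
      unfolding K' QA[OF MP _ j(2), of m, unfolded r_def, simplified] step[OF P] .
  qed
  \<comment> \<open>Dually, row \<open>i\<close> of \<open>Q\<close> kills \<open>X\<close> and
    hence all columns of \<open>V\<close>, that is \<open>M ^ s * W\<close> for
    \<open>s \<le> m\<close>. Maximality adds \<open>s = m + 1\<close>, so this row multiplied by
    \<open>M\<close> still kills \<open>V\<close> and \<open>X\<close>.\<close>
  have left: "K $$ (i, j) = 0" if i: "r \<le> i" "i < n" and j: "j < r" for i j
  proof -
    define G where "G = mat 1 n (\<lambda>(_, j). Q $$ (i, j))"
    have G: "G \<in> carrier_mat 1 n"
      by (simp add: G_def)
    have GA: "(G * A) $$ (0, l) = (Q * A) $$ (i, l)" if "A \<in> carrier_mat n c" "l < c" for A l c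
      by (rule index_mult_mat_cong[OF G that(1) _ that(2) Q that(1) i(2) that(2)]) (auto simp: G_def)
    have GX: "G * X = 0\<^sub>m 1 r"
    proof (rule eq_matI)
      fix a l assume "a < dim_row (0\<^sub>m 1 r :: 'a mat)" "l < dim_col (0\<^sub>m 1 r :: 'a mat)"
      then have l: "a = 0" "l < r" "l < n"
        using rn by auto
      have "(G * X) $$ (0, l) = (G * P) $$ (0, l)"
        by (rule index_mult_mat_cong[OF G X _ l(2) G P _ l(3)]) (use PX l in auto)
      also have "\<dots> = (Q * P) $$ (i, l)"
        by (rule GA[OF P l(3)])
      finally show "(G * X) $$ (a, l) = 0\<^sub>m 1 r $$ (a, l)"
        unfolding PQ using i l by simp
    qed (use G X in auto)
    have "G * V = G * X * (Y * V)"
      by (subst VX) (rule assoc_mult_mat[OF G X YVc, symmetric])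
    then have GV: "G * V = 0\<^sub>m 1 r"
      unfolding GX using left_mult_zero_mat[OF YVc] by simp
    have kr: "krylov M G W s = (G * (M ^\<^sub>m s * W)) $$ (0, 0)" for s
      using krylov_add[OF M G W, of 0 s] G M by simp
    have "krylov M G W s = 0" if "s \<le> m" for s
    proof -
      have s: "m - s < r" "m - (m - s) = s"
        using that by (auto simp: r_def)
      have "krylov M G W s = (G * V) $$ (0, m - s)"
        unfolding kr using AMW[OF G _ s(1)] s(2) by simp
      then show ?thesis
        unfolding GV using s(1) by simp
    qed
    moreover from this have "krylov M G W (Suc m) = 0"
      using max[OF G W] by blast
    ultimately have all: "krylov M G W s = 0" if "s \<le> Suc m" for s
      using that by (auto simp: le_Suc_eq)
    have GM: "G * M \<in> carrier_mat 1 n"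
      using G M by simp
    have "G * M * V = 0\<^sub>m 1 r"
    proof (rule eq_matI)
      fix a l assume "a < dim_row (0\<^sub>m 1 r :: 'a mat)" "l < dim_col (0\<^sub>m 1 r :: 'a mat)"
      then have l: "a = 0" "l < r"
        by auto
      have "(G * M * V) $$ (0, l) = (G * M * (M ^\<^sub>m (m - l) * W)) $$ (0, 0)"
        by (rule AMW[OF GM _ l(2)]) simp
      also have "\<dots> = krylov M G W (1 + (m - l))"
        unfolding krylov_add[OF M G W] using M by simp
      also have "\<dots> = 0"
        using l by (intro all) (simp add: r_def)
      finally show "(G * M * V) $$ (a, l) = 0\<^sub>m 1 r $$ (a, l)"
        using l by simp
    qed (use G V in auto)
    then have GMX: "G * M * X = 0\<^sub>m 1 r"
      unfolding X_def using assoc_mult_mat[OF GM V Z] Z by simp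
    have jn: "j < n"
      using j rn by simp
    have "K $$ (i, j) = (G * (M * P)) $$ (0, j)"
      unfolding K' using GA[OF MP jn] by simp
    also have "G * (M * P) = G * M * P"
      using assoc_mult_mat[OF G M P] by simp
    also have "(G * M * P) $$ (0, j) = (G * M * X) $$ (0, j)"
      by (rule index_mult_mat_cong[OF GM P _ jn GM X _ j]) (use PX j in auto)
    finally show ?thesis
      unfolding GMX using j by simp
  qed
  define t where "t = n - r"
  define H where "H = mat r r (\<lambda>(i, j). K $$ (i, j))"
  define M' where "M' = mat t t (\<lambda>(i, j). K $$ (i + r, j + r))"
  have n: "n = r + t"
    using rn by (simp add: t_def)
  have "K = four_block_mat H (0\<^sub>m r t) (0\<^sub>m t r) M'"
  proof (rule eq_matI)
    fix i j assume "i < dim_row (four_block_mat H (0\<^sub>m r t) (0\<^sub>m t r) M')"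
      "j < dim_col (four_block_mat H (0\<^sub>m r t) (0\<^sub>m t r) M')"
    then have ij: "i < n" "j < n"
      by (auto simp: H_def M'_def n)
    have "K $$ (i, j) = 0" if "i < r" "r \<le> j"
      using that ij top[of i j] topright[of j] by (cases "i = m") (auto simp: r_def)
    then show "K $$ (i, j) = four_block_mat H (0\<^sub>m r t) (0\<^sub>m t r) M' $$ (i, j)"
      using ij left[of i j] n by (auto simp: H_def M'_def)
  qed (use K n in \<open>auto simp: H_def M'_def\<close>)
  then have "similar_mat M (four_block_mat H (0\<^sub>m r t) (0\<^sub>m t r) M')"
    using sim by simp
  moreover have "companion_like H"
    unfolding companion_like_def using top rn by (auto simp: H_def r_def)
  moreover have "H \<in> carrier_mat r r" "M' \<in> carrier_mat t t"
    by (auto simp: H_def M'_def)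
  ultimately show ?thesis
    using n unfolding r_def by blast
qed

section \<open>Arbitrary matrices\<close>

text \<open>Lengths are below \<open>n\<close> by \<open>krylov_length_less_dim\<close>, and a first
  basis vector with its coordinate functional has length 0. A pair violating maximality would, after
  division by its first nonzero value, give length \<open>Max T + 1\<close>.\<close>

lemma exists_maximal_krylov_pair:
  fixes M :: "'a :: field mat"
  assumes M: "M \<in> carrier_mat n n" and n: "0 < n"
  shows "\<exists>m. \<exists>F\<in>carrier_mat 1 n. \<exists>W\<in>carrier_mat n 1. (\<forall>i<m. krylov M F W i = 0) \<and> krylov M F W m = 1 \<and>
    (\<forall>G\<in>carrier_mat 1 n. \<forall>C\<in>carrier_mat n 1. (\<forall>i\<le>m. krylov M G C i = 0) \<longrightarrow> krylov M G C (Suc m) = 0)"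
proof -
  define T where "T = {m. \<exists>F\<in>carrier_mat 1 n. \<exists>W\<in>carrier_mat n 1.
    (\<forall>i<m. krylov M F W i = 0) \<and> krylov M F W m = 1}"
  have memT: "m \<in> T" if "F \<in> carrier_mat 1 n" "W \<in> carrier_mat n 1"
    "\<forall>i<m. krylov M F W i = 0" "krylov M F W m = 1" for m F W
    using that unfolding T_def by blast
  have bound: "T \<subseteq> {..<n}"
    using krylov_length_less_dim[OF M] by (auto simp: T_def)
  then have fin: "finite T"
    by (rule finite_subset) simp
  define F0 where "F0 = mat 1 n (\<lambda>(_, j). if j = 0 then 1 else 0 :: 'a)"
  define W0 where "W0 = mat n 1 (\<lambda>(i, _). if i = 0 then 1 else 0 :: 'a)"
  have F0: "F0 \<in> carrier_mat 1 n" and W0: "W0 \<in> carrier_mat n 1"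
    by (auto simp: F0_def W0_def)
  have "(F0 * W0) $$ (0, 0) = (\<Sum>k<n. F0 $$ (0, k) * W0 $$ (k, 0))"
    by (rule index_mult_mat_sum[OF F0 W0]) auto
  also have "\<dots> = (\<Sum>k<n. if k = 0 then 1 else 0)"
    by (rule sum.cong) (auto simp: F0_def W0_def)
  also have "\<dots> = 1"
    using n by simp
  finally have "krylov M F0 W0 0 = 1"
    using F0 M by (simp add: krylov_def)
  then have "0 \<in> T"
    using memT[OF F0 W0] by simp
  then have "Max T \<in> T"
    using fin by (intro Max_in) auto
  then obtain F W where FW: "F \<in> carrier_mat 1 n" "W \<in> carrier_mat n 1"
    "\<forall>i<Max T. krylov M F W i = 0" "krylov M F W (Max T) = 1"
    by (auto simp: T_def)
  have "\<forall>G\<in>carrier_mat 1 n. \<forall>C\<in>carrier_mat n 1.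
    (\<forall>i\<le>Max T. krylov M G C i = 0) \<longrightarrow> krylov M G C (Suc (Max T)) = 0"
  proof (intro ballI impI)
    fix G C
    assume G: "G \<in> carrier_mat 1 n" and C: "C \<in> carrier_mat n 1"
      and z: "\<forall>i\<le>Max T. krylov M G C i = 0"
    show "krylov M G C (Suc (Max T)) = 0"
    proof (rule ccontr)
      assume ne: "krylov M G C (Suc (Max T)) \<noteq> 0"
      define c where "c = krylov M G C (Suc (Max T))"
      have G': "(1 / c) \<cdot>\<^sub>m G \<in> carrier_mat 1 n"
        using G by simp
      have scale: "krylov M ((1 / c) \<cdot>\<^sub>m G) C i = (1 / c) * krylov M G C i" for i
      proof -
        have "G * M ^\<^sub>m i \<in> carrier_mat 1 n"
          using G M by auto
        then have "(1 / c) \<cdot>\<^sub>m G * M ^\<^sub>m i * C = (1 / c) \<cdot>\<^sub>m (G * M ^\<^sub>m i * C)"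
          unfolding mult_smult_assoc_mat[OF G pow_carrier_mat[OF M]] using C by (rule mult_smult_assoc_mat)
        then show ?thesis
          unfolding krylov_def using G M C by simp
      qed
      have "Suc (Max T) \<in> T"
        by (rule memT[OF G' C]) (use scale z ne in \<open>auto simp: c_def less_Suc_eq_le\<close>)
      then show False
        using Max_ge[OF fin] by fastforce
    qed
  qed
  then show ?thesis
    using FW by blast
qed

lemma sum_of_diagonalizable_in_all:
  fixes M :: "'a :: field mat"
  assumes M: "M \<in> carrier_mat n n"
    and two: "\<And>c. \<exists>x\<in>S. \<exists>y\<in>S. c = x + y"
    and S: "0 \<in> S" "1 \<in> S" "finite S" "6 \<le> card S"
  shows "sum_of_diagonalizable_in S M"
  using M
proof (induction n arbitrary: M rule: less_induct)
  case (less n)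
  note M = less.prems
  show ?case
  \<comment> \<open>The empty matrix is the base case, reached when the split-off block is the whole
    matrix.\<close>
  proof (cases "n = 0")
    case True
    then have "M = M + M" "M = mat_diag 0 (\<lambda>_. 0)"
      using M by (auto intro!: eq_matI)
    moreover have "similar_mat M M"
      using M by (rule similar_mat_refl)
    ultimately show ?thesis
      unfolding sum_of_diagonalizable_in_def diagonalizable_in_def using M True
      by (intro exI[of _ M] conjI exI[of _ "\<lambda>_. 0"]) auto
  next
    case False
    then have "0 < n"
      by simp
    then obtain m F W where kr: "F \<in> carrier_mat 1 n" "W \<in> carrier_mat n 1"
      "\<forall>i<m. krylov M F W i = 0" "krylov M F W m = 1"
      "\<forall>G\<in>carrier_mat 1 n. \<forall>C\<in>carrier_mat n 1. (\<forall>i\<le>m. krylov M G C i = 0) \<longrightarrow> krylov M G C (Suc m) = 0"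
      using exists_maximal_krylov_pair[OF M] by blast
    have "\<exists>H M' t. n = Suc m + t \<and> H \<in> carrier_mat (Suc m) (Suc m) \<and> M' \<in> carrier_mat t t \<and>
      companion_like H \<and> similar_mat M (four_block_mat H (0\<^sub>m (Suc m) t) (0\<^sub>m t (Suc m)) M')"
      by (rule cyclic_block_splits_off[OF M kr(1,2) _ kr(4)]) (use kr(3,5) in auto)
    then obtain H M' t where n: "n = Suc m + t" and H: "H \<in> carrier_mat (Suc m) (Suc m)" "companion_like H"
      and M': "M' \<in> carrier_mat t t"
      and sim: "similar_mat M (four_block_mat H (0\<^sub>m (Suc m) t) (0\<^sub>m t (Suc m)) M')"
      by blast
    have "sum_of_diagonalizable_in S H"
      by (rule sum_of_diagonalizable_in_companion_like[OF H(1) _ H(2) two S]) simp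
    moreover have "sum_of_diagonalizable_in S M'"
      using n by (intro less.IH[OF _ M']) simp
    ultimately show ?thesis
      by (intro sum_of_diagonalizable_in_similar[OF sim] sum_of_diagonalizable_in_four_block[OF _ _ H(1) M'])
  qed
qed

section \<open>From diagonalizations to split semisimple \<open>k\<close>-th roots\<close>

lemma mat_diag_pow:
  fixes e :: "nat \<Rightarrow> 'a :: comm_semiring_1"
  shows "mat_diag n e ^\<^sub>m k = mat_diag n (\<lambda>i. e i ^ k)"
  by (induction k) (auto simp: mult.commute)

lemma poly_at_mat_diagonalized:
  fixes A :: "'a :: field mat"
  assumes A: "A \<in> carrier_mat n n" and w: "similar_mat_wit A (mat_diag n e) P Q"
  shows "poly_at_mat f A = P * mat_diag n (\<lambda>i. poly f (e i)) * Q"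
proof -
  note w' = similar_mat_witD2[OF A w]
  have entry: "(P * mat_diag n g * Q) $$ (i, j) = (\<Sum>k<n. P $$ (i, k) * g k * Q $$ (k, j))"
    if "i < n" "j < n" for g i j
  proof -
    have "P * mat_diag n g \<in> carrier_mat n n"
      using w' by simp
    from index_mult_mat_sum[OF this w'(7) that] show ?thesis
      unfolding mat_diag_mult_right[OF w'(6)] using that by simp
  qed
  show ?thesis
  proof (rule eq_matI)
    fix i j
    assume "i < dim_row (P * mat_diag n (\<lambda>i. poly f (e i)) * Q)"
      "j < dim_col (P * mat_diag n (\<lambda>i. poly f (e i)) * Q)"
    then have ij: "i < n" "j < n"
      using w' by auto
    have "poly_at_mat f A $$ (i, j) = (\<Sum>m\<le>degree f. coeff f m * (A ^\<^sub>m m) $$ (i, j))"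
      using ij A by (simp add: poly_at_mat_def)
    also have "\<dots> = (\<Sum>m\<le>degree f. \<Sum>k<n. P $$ (i, k) * (coeff f m * e k ^ m) * Q $$ (k, j))"
    proof (rule sum.cong)
      fix m
      show "coeff f m * (A ^\<^sub>m m) $$ (i, j) = (\<Sum>k<n. P $$ (i, k) * (coeff f m * e k ^ m) * Q $$ (k, j))"
        unfolding similar_mat_wit_pow_id[OF w] mat_diag_pow entry[OF ij] sum_distrib_left
        by (rule sum.cong) (auto simp: algebra_simps)
    qed simp
    also have "\<dots> = (\<Sum>k<n. \<Sum>m\<le>degree f. P $$ (i, k) * (coeff f m * e k ^ m) * Q $$ (k, j))"
      by (rule sum.swap)
    also have "\<dots> = (\<Sum>k<n. P $$ (i, k) * poly f (e k) * Q $$ (k, j))"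
      by (simp add: poly_altdef sum_distrib_left sum_distrib_right)
    finally show "poly_at_mat f A $$ (i, j) = (P * mat_diag n (\<lambda>i. poly f (e i)) * Q) $$ (i, j)"
      using entry[OF ij] by simp
  qed (use A w' in \<open>auto simp: poly_at_mat_def\<close>)
qed

lemma annihilates_diagonalizable_iff:
  fixes A :: "'a :: field mat"
  assumes A: "A \<in> carrier_mat n n" and sim: "similar_mat A (mat_diag n e)"
  shows "annihilates f A \<longleftrightarrow> (\<forall>i<n. poly f (e i) = 0)"
proof -
  obtain P Q where w: "similar_mat_wit A (mat_diag n e) P Q"
    using sim unfolding similar_mat_def by blast
  note w' = similar_mat_witD2[OF A w]
  let ?D = "mat_diag n (\<lambda>i. poly f (e i))"
  have D: "?D \<in> carrier_mat n n"
    by simp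
  have "P * ?D * Q = 0\<^sub>m n n \<longleftrightarrow> ?D = 0\<^sub>m n n"
  proof
    assume z: "P * ?D * Q = 0\<^sub>m n n"
    have "similar_mat_wit (P * ?D * Q) ?D P Q"
      using w' D by (intro similar_mat_witI[of _ _ n]) auto
    then have "?D = Q * (P * ?D * Q) * P"
      using similar_mat_witD2(3)[OF D similar_mat_wit_sym] by blast
    then show "?D = 0\<^sub>m n n"
      unfolding z using w' by simp
  next
    assume "?D = 0\<^sub>m n n"
    then show "P * ?D * Q = 0\<^sub>m n n"
      using w' by simp
  qed
  also have "\<dots> \<longleftrightarrow> (\<forall>i<n. poly f (e i) = 0)"
  proof
    assume z: "?D = 0\<^sub>m n n"
    show "\<forall>i<n. poly f (e i) = 0"
    proof clarify
      fix i assume "i < n"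
      then have "?D $$ (i, i) = poly f (e i)"
        by (simp add: mat_diag_def)
      then show "poly f (e i) = 0"
        unfolding z using \<open>i < n\<close> by simp
    qed
  qed (auto simp: mat_diag_def intro!: eq_matI)
  finally show ?thesis
    unfolding annihilates_def poly_at_mat_diagonalized[OF A w] using A by simp
qed

text \<open>The product runs over the set \<open>E\<close> of eigenvalues, so its linear factors are
  distinct. An annihilating polynomial vanishes on \<open>E\<close>, and a nonzero one has degree at
  least \<open>card E\<close>.\<close>

lemma split_semisimple_if_diagonalizable:
  fixes A :: "'a :: field mat"
  assumes A: "A \<in> carrier_mat n n" and sim: "similar_mat A (mat_diag n e)"
  shows "split_semisimple A"
proof -
  define E where "E = e ` {..<n}"
  define f where "f = (\<Prod>a\<in>E. [:- a, 1:])"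
  define R where "R = (\<lambda>a. [:- a, 1:]) ` E"
  have fin: "finite E"
    by (simp add: E_def)
  have "f = \<Prod>R"
    unfolding f_def R_def by (subst prod.reindex) (auto simp: inj_on_def)
  moreover have "finite R" "\<forall>g\<in>R. lead_coeff g = 1 \<and> degree g = 1"
    using fin by (auto simp: R_def)
  moreover have "is_minimal_poly A f"
    unfolding is_minimal_poly_def
  proof (intro conjI allI impI)
    show "lead_coeff f = 1"
      unfolding f_def lead_coeff_prod by simp
    show "annihilates f A"
      unfolding annihilates_diagonalizable_iff[OF A sim] f_def
      using fin by (auto simp: poly_prod E_def intro!: prod_zero)
    fix g :: "'a poly"
    assume g: "g \<noteq> 0 \<and> annihilates g A"
    then have "E \<subseteq> {x. poly g x = 0}"
      unfolding annihilates_diagonalizable_iff[OF A sim] by (auto simp: E_def)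
    then have "card E \<le> card {x. poly g x = 0}"
      using g by (intro card_mono poly_roots_finite) auto
    also have "\<dots> \<le> degree g"
      using g by (intro card_poly_roots_bound) auto
    finally have "card E \<le> degree g" .
    moreover have "degree f \<le> (\<Sum>a\<in>E. degree [:- a, 1:])"
      unfolding f_def using degree_prod_sum_le[OF fin, of "\<lambda>a. [:- a, 1:]"] by (simp add: o_def)
    ultimately show "degree f \<le> degree g"
      by simp
  qed
  ultimately show ?thesis
    unfolding split_semisimple_def using A by auto
qed

text \<open>Take \<open>k\<close>-th roots of the eigenvalues and keep the conjugating
  matrices.\<close>

lemma diagonalizable_in_powers_root:
  fixes A :: "'a :: field mat"
  assumes A: "A \<in> carrier_mat n n" and d: "diagonalizable_in (range (\<lambda>y. y ^ k)) A"
  obtains B where "B \<in> carrier_mat n n" "split_semisimple B" "A = B ^\<^sub>m k"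
proof -
  obtain f where f: "\<forall>i<n. f i \<in> range (\<lambda>y :: 'a. y ^ k)" and sim: "similar_mat A (mat_diag n f)"
    using d A unfolding diagonalizable_in_def by auto
  from f have "\<forall>i\<in>{..<n}. \<exists>y. f i = y ^ k"
    by auto
  then obtain g where g: "\<forall>i\<in>{..<n}. f i = g i ^ k"
    by metis
  obtain P Q where w: "similar_mat_wit A (mat_diag n f) P Q"
    using sim unfolding similar_mat_def by blast
  note w' = similar_mat_witD2[OF A w]
  define B where "B = P * mat_diag n g * Q"
  have B: "B \<in> carrier_mat n n"
    using w' unfolding B_def by auto
  have wB: "similar_mat_wit B (mat_diag n g) P Q"
    using w' B by (intro similar_mat_witI[of _ _ n]) (auto simp: B_def)
  have "mat_diag n f = mat_diag n (\<lambda>i. g i ^ k)"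
    using g by (intro eq_matI) (auto simp: mat_diag_def)
  then have "A = B ^\<^sub>m k"
    unfolding similar_mat_wit_pow_id[OF wB] mat_diag_pow using w'(3) by simp
  moreover have "split_semisimple B"
    using wB by (intro split_semisimple_if_diagonalizable[OF B]) (auto simp: similar_mat_def)
  ultimately show thesis
    using that B by blast
qed

theorem theorem1p7:
  fixes p l q n k d :: nat
    and M :: "'a :: {field, finite} mat"
  assumes "prime p"
    and "q = p ^ l"
    and "CARD('a) = q"
    and "n \<ge> 2"
    and "k \<ge> 1"
    and "d = gcd k (q - 1)"
    and "q \<ge> (d - 1) ^ 4 + 6 * d"
    and "M \<in> carrier_mat n n"
  shows "\<exists>A \<in> carrier_mat n n. \<exists>B \<in> carrier_mat n n.
           split_semisimple A \<and> split_semisimple B \<and> M = A ^\<^sub>m k + B ^\<^sub>m k"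
proof -
  define h where "h = (q - 1) div d"
  define S where "S = range (\<lambda>y :: 'a. y ^ k)"
  have S: "S = {x. x = 0 \<or> x ^ h = 1}"
    using range_power_iff[OF \<open>k \<ge> 1\<close>, where 'a = 'a] assms(3,6) by (auto simp: S_def h_def)
  have qdh: "q - 1 = d * h"
    using assms(6) by (simp add: h_def)
  have d: "0 < d"
    using assms(5,6) by simp
  have q1: "1 < q"
    using CARD_field_gt_1[where 'a = 'a] assms(3) by simp
  \<comment> \<open>Otherwise \<open>q - 1 \<le> 4 * d\<close>, against
    \<open>q \<ge> 6 * d\<close>. Together with 0 this yields the six elements of \<open>S\<close>
    required by \<open>exists_sum_of_four_distinct\<close>.\<close>
  have "5 \<le> h"
  proof (rule ccontr)
    assume "\<not> 5 \<le> h"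
    then have "d * h \<le> d * 4"
      by (intro mult_le_mono2) simp
    then show False
      using qdh assms(7) d q1 by linarith
  qed
  then have h: "0 < h"
    by simp
  have two: "\<exists>x\<in>S. \<exists>y\<in>S. c = x + y" for c
    by (rule all_sums_of_two_powers[OF _ _ S]) (use qdh assms(3,7) in auto)
  have "S = insert 0 {x. x ^ h = 1}"
    unfolding S by auto
  moreover have "card {x :: 'a. x ^ h = 1} = h"
    by (rule card_roots_of_unity[OF _ h]) (use qdh assms(3) in auto)
  ultimately have "6 \<le> card S"
    using h \<open>5 \<le> h\<close> by (simp add: power_0_left)
  moreover have "0 \<in> S" "1 \<in> S"
    unfolding S by auto
  ultimately have "sum_of_diagonalizable_in S M"
    by (intro sum_of_diagonalizable_in_all[OF assms(8) two]) auto
  then obtain A B where A: "A \<in> carrier_mat n n" "diagonalizable_in S A"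
    and B: "B \<in> carrier_mat n n" "diagonalizable_in S B" and M: "M = A + B"
    using assms(8) unfolding sum_of_diagonalizable_in_def by auto
  obtain A' where "A' \<in> carrier_mat n n" "split_semisimple A'" "A = A' ^\<^sub>m k"
    using diagonalizable_in_powers_root[OF A(1) A(2)[unfolded S_def]] .
  moreover obtain B' where "B' \<in> carrier_mat n n" "split_semisimple B'" "B = B' ^\<^sub>m k"
    using diagonalizable_in_powers_root[OF B(1) B(2)[unfolded S_def]] .
  ultimately show ?thesis
    using M by blast
qed

end
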